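(* Let $0<q<1$, $s=\sqrt{[2]/2}$, and let $D$ be the operator on $\Omega^{(0,\bullet)}=\Omega^{(0,0)}\oplus\Omega^{(0,1)}\oplus\Omega^{(0,2)}$ given by $D(a,v,b)=(\bar\partial^\dagger v,\ \bar\partial a+s\,\bar\partial^\dagger b,\ s\,\bar\partial v)$. Then $\Delta_{\bar\partial}:=D^2$ is given by $$\Delta_{\bar\partial}\,\omega=[2]^{-1}(\mathcal{C}_q-2)\blacktriangleright\omega\qquad\text{for all }\omega\in\Omega^{(0,\bullet)},$$ where $\mathcal{C}_q$ is the Casimir element of (the extended) $U_q(su(3))$ acting componentwise.
   Context: Notation: $0<q<1$, $[z]=(q^z-q^{-z})/(q-q^{-1})$, $[a,b]_q=ab-q^{-1}ba$. $U_q(su(3))$ is the Hopf $*$-algebra generated by $K_i=K_i^*$, $K_i^{-1}$, $E_i$, $F_i=E_i^*$ ($i=1,2$) with relations $[K_1,K_2]=0$, $K_iE_iK_i^{-1}=qE_i$, $[E_i,F_i]=(q-q^{-1})^{-1}(K_i^2-K_i^{-2})$, and for $i\ne j$: $K_iE_jK_i^{-1}=q^{-1/2}E_j$, $[E_i,F_j]=0$, $E_i^2E_j-(q+q^{-1})E_iE_jE_i+E_jE_i^2=0$. Coproduct $\Delta(K_i)=K_i\otimes K_i$, $\Delta(E_i)=E_i\otimes K_i+K_i^{-1}\otimes E_i$ (hence $\Delta(F_i)=F_i\otimes K_i+K_i^{-1}\otimes F_i$), counit $\epsilon(K_i)=1$, $\epsilon(E_i)=0$, antipode $S(K_i)=K_i^{-1}$,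 $S(E_i)=-qE_i$. It is extended by adjoining $H=(K_1K_2^{-1})^{2/3}$ and $H^{-1}$: $H=H^*$ is group-like, commutes with the $K_i$, $HE_1H^{-1}=qE_1$, $HE_2H^{-1}=q^{-1}E_2$, $H^3=(K_1K_2^{-1})^2$; the extension is still denoted $U_q(su(3))$. $U_q(su(2))$ is the sub Hopf $*$-algebra generated by $K_1^{\pm1},E_1,F_1$. $\vartheta$ is the linear antimultiplicative map of $U_q(su(3))$ with $\vartheta(K_i)=K_i$, $\vartheta(H)=H$, $\vartheta(E_i)=F_i$, $\vartheta(F_i)=E_i$. The Casimir element is $$\mathcal{C}_q=(q-q^{-1})^{-2}\Big((H+H^{-1})\{(qK_1K_2)^2+(qK_1K_2)^{-2}\}+H^2+H^{-2}-6\Big)+(qHK_2^2+q^{-1}H^{-1}K_2^{-2})F_1E_1+(qH^{-1}K_1^2+q^{-1}HK_1^{-2})F_2E_2+qH[F_2,F_1]_q[E_1,E_2]_q+qH^{-1}[F_1,F_2]_q[E_2,E_1]_q.$$ $\mathcal{A}(SU_q(3))$ is the Hopf $*$-algebra generated by $u^i_j$ ($i,j=1,2,3$) with relations $u^i_ku^j_k=qu^j_ku^i_k$, $u^k_iu^k_j=qu^k_ju^k_i$ for $i<j$; $[u^i_l,u^j_k]=0$, $[u^i_k,u^j_l]=(q-q^{-1})u^i_lu^j_k$ for $i<j$, $k<l$; $\sum_{\pi\in S_3}(-q)^{\ell(\pi)}u^1_{\pi(1)}u^2_{\pi(2)}u^3_{\pi(3)}=1$ ($\ell$ = length); $(u^i_j)^*=(-q)^{j-i}(u^{k_1}_{l_1}u^{k_2}_{l_2}-qu^{k_1}_{l_2}u^{k_2}_{l_1})$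 with $\{k_1<k_2\}=\{1,2,3\}\setminus\{i\}$, $\{l_1<l_2\}=\{1,2,3\}\setminus\{j\}$; $\Delta(u^i_j)=\sum_ku^i_k\otimes u^k_j$, $\epsilon(u^i_j)=\delta^i_j$, $S(u^i_j)=(u^j_i)^*$. The non-degenerate dual pairing with $U_q(su(3))$ is determined by $\langle h,u^i_j\rangle=\sigma^i_j(h)$ (row $i$, column $j$), where $\sigma$ is the $*$-representation on $\mathbb{C}^3$ with $\sigma(K_1)=\mathrm{diag}(q^{-1/2},q^{1/2},1)$, $\sigma(K_2)=\mathrm{diag}(1,q^{-1/2},q^{1/2})$, $\sigma(H)=\mathrm{diag}(q^{-1/3},q^{2/3},q^{-1/3})$, $\sigma(E_1)$ = matrix unit with 1 in row 2, column 1, $\sigma(E_2)$ = matrix unit with 1 in row 3, column 2. The left action $\blacktriangleright$ of $U_q(su(3))$ on $\mathcal{A}(SU_q(3))$ is $h\blacktriangleright a=\langle\vartheta(h),a_{(1)}\rangle a_{(2)}$; it makes $\mathcal{A}(SU_q(3))$ a module $*$-algebra. $\mathcal{A}(S^5_q)=\{a\in\mathcal{A}(SU_q(3)): h\blacktriangleright a=\epsilon(h)a\ \forall h\in U_q(su(2))\}$; $\mathcal{L}_N=\{a\in\mathcal{A}(S^5_q): K_1K_2^2\blacktriangleright a=q^Na\}$. Antiholomorphic forms on the quantum projective plane: $\Omega^{(0,0)}=\mathcal{L}_0$, $\Omega^{(0,2)}=\mathcal{L}_3$, and $\Omega^{(0,1)}$ is the set of $v=(v_+,v_-)\in\mathcal{A}(SU_q(3))^2$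 with $K_1K_2^2\blacktriangleright v=q^{3/2}v$, $K_1\blacktriangleright(v_+,v_-)=(q^{1/2}v_+,q^{-1/2}v_-)$, $E_1\blacktriangleright(v_+,v_-)=(0,v_+)$, $F_1\blacktriangleright(v_+,v_-)=(v_-,0)$ (actions on vectors are componentwise). Put $X=F_2F_1-2[2]^{-1}F_1F_2$, $Y=E_2E_1-2[2]^{-1}E_1E_2$. Then $\bar\partial a=(X^*\blacktriangleright a,\,E_2\blacktriangleright a)$ for $a\in\Omega^{(0,0)}$; $\bar\partial v=-E_2\blacktriangleright v_+-Y\blacktriangleright v_-$ for $v\in\Omega^{(0,1)}$ (an element of $\Omega^{(0,2)}$); $\bar\partial^\dagger b=(-F_2\blacktriangleright b,\,-Y^*\blacktriangleright b)$ for $b\in\Omega^{(0,2)}$ (an element of $\Omega^{(0,1)}$); $\bar\partial^\dagger v=X\blacktriangleright v_++F_2\blacktriangleright v_-$ for $v\in\Omega^{(0,1)}$ (an element of $\Omega^{(0,0)}$). *)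

theory Defs
  imports
    "HOL-Analysis.Finite_Cartesian_Product"
    "HOL-Library.Poly_Mapping"
    "HOL-Algebra.QuotRing"
begin

section \<open>Complex algebras presented by generators and relations\<close>

text \<open>
  Lists form the free monoid, so \<open>'g list \<Rightarrow>\<^sub>0 complex\<close>, with the convolution product of
  \<^theory>\<open>HOL-Library.Poly_Mapping\<close>, is the free unital complex algebra on \<open>'g\<close>, and
  \<open>('g list \<times> 'g list) \<Rightarrow>\<^sub>0 complex\<close> (componentwise concatenation) is its tensor square:
  \<open>single (v, w) 1\<close> is the elementary tensor of the words \<open>v\<close> and \<open>w\<close>.
\<close>

instantiation list :: (type) monoid_add
begin
definition zero_list :: "'a list" where "zero_list = []"
definition plus_list :: "'a list \<Rightarrow> 'a list \<Rightarrow> 'a list" where "plus_list = (@)"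
instance by standard (simp_all add: zero_list_def plus_list_def)
end

definition scalar :: "complex \<Rightarrow> ('m::monoid_add \<Rightarrow>\<^sub>0 complex)" where
  "scalar c = Poly_Mapping.single 0 c"

definition gen :: "'g \<Rightarrow> ('g list \<Rightarrow>\<^sub>0 complex)" where
  "gen g = Poly_Mapping.single [g] 1"

text \<open>The unital algebra homomorphism extending \<open>f\<close>; the map \<open>\<iota>\<close> embeds the scalars
  in the target.\<close>

definition alg_ext ::
  "(complex \<Rightarrow> 'r::ring_1) \<Rightarrow> ('g \<Rightarrow> 'r) \<Rightarrow> ('g list \<Rightarrow>\<^sub>0 complex) \<Rightarrow> 'r" where
  "alg_ext \<iota> f x = (\<Sum>w\<in>Poly_Mapping.keys x. \<iota> (Poly_Mapping.lookup x w) * prod_list (map f w))"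

definition free_ring :: "('g list \<Rightarrow>\<^sub>0 complex) ring" where
  "free_ring = \<lparr>carrier = UNIV, mult = (*), one = 1, zero = 0, add = (+)\<rparr>"

text \<open>Ideals of \<^const>\<open>free_ring\<close> are complex subspaces because the scalars lie in the ring.\<close>

definition presented ::
  "('g list \<Rightarrow>\<^sub>0 complex) set \<Rightarrow> ('g list \<Rightarrow>\<^sub>0 complex) set ring" where
  "presented R = free_ring Quot (genideal free_ring R)"

definition residue ::
  "('g list \<Rightarrow>\<^sub>0 complex) set \<Rightarrow> ('g list \<Rightarrow>\<^sub>0 complex) \<Rightarrow> ('g list \<Rightarrow>\<^sub>0 complex) set" where
  "residue R x = genideal free_ring R +>\<^bsub>free_ring\<^esub> x"

definition qnum :: "real \<Rightarrow> real \<Rightarrow> real" where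
  "qnum q z = (q powr z - q powr (- z)) / (q - 1 / q)"


section \<open>The extended Hopf *-algebra of quantum su(3)\<close>

datatype node = N1 | N2

datatype ugen = gK node | gKi node | gH | gHi | gE node | gF node

type_synonym ufree = "ugen list \<Rightarrow>\<^sub>0 complex"

abbreviation K :: "node \<Rightarrow> ufree" where "K i \<equiv> gen (gK i)"
abbreviation Ki :: "node \<Rightarrow> ufree" where "Ki i \<equiv> gen (gKi i)"
abbreviation H :: ufree where "H \<equiv> gen gH"
abbreviation Hi :: ufree where "Hi \<equiv> gen gHi"
abbreviation E :: "node \<Rightarrow> ufree" where "E i \<equiv> gen (gE i)"
abbreviation F :: "node \<Rightarrow> ufree" where "F i \<equiv> gen (gF i)"

text \<open>On generators, the involution and the antimultiplicative map \<open>\<vartheta>\<close> agree.\<close>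

fun swap_gen :: "ugen \<Rightarrow> ugen" where
  "swap_gen (gE i) = gF i"
| "swap_gen (gF i) = gE i"
| "swap_gen g = g"

definition star_free :: "ufree \<Rightarrow> ufree" where
  "star_free x = (\<Sum>w\<in>Poly_Mapping.keys x.
     Poly_Mapping.single (rev (map swap_gen w)) (cnj (Poly_Mapping.lookup x w)))"

definition theta_free :: "ufree \<Rightarrow> ufree" where
  "theta_free x = (\<Sum>w\<in>Poly_Mapping.keys x.
     Poly_Mapping.single (rev (map swap_gen w)) (Poly_Mapping.lookup x w))"

definition U_rels0 :: "real \<Rightarrow> ufree set" where
  "U_rels0 q =
     (\<Union>i. {K i * Ki i - 1, Ki i * K i - 1}) \<union>
     {H * Hi - 1, Hi * H - 1} \<union>
     {K N1 * K N2 - K N2 * K N1} \<union>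
     (\<Union>i. {K i * E i * Ki i - scalar q * E i,
           (E i * F i - F i * E i) - scalar (1 / (q - 1 / q)) * ((K i)^2 - (Ki i)^2)}) \<union>
     (\<Union>(i, j)\<in>{(i, j). i \<noteq> j}.
          {K i * E j * Ki i - scalar (q powr (- 1 / 2)) * E j,
           E i * F j - F j * E i,
           (E i)^2 * E j - scalar (q + 1 / q) * E i * E j * E i + E j * (E i)^2}) \<union>
     (\<Union>i. {H * K i - K i * H}) \<union>
     {H * E N1 * Hi - scalar q * E N1,
      H * E N2 * Hi - scalar (1 / q) * E N2,
      H^3 - (K N1 * Ki N2)^2}"

text \<open>A presentation as a *-algebra also imposes the adjoint of every relation.\<close>

definition U_rels :: "real \<Rightarrow> ufree set" where
  "U_rels q = U_rels0 q \<union> star_free ` U_rels0 q"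

definition Uq :: "real \<Rightarrow> ufree set ring" where
  "Uq q = presented (U_rels q)"

abbreviation ucl :: "real \<Rightarrow> ufree \<Rightarrow> ufree set" where
  "ucl q x \<equiv> residue (U_rels q) x"

text \<open>The relations are closed under the involution, so the image of a coset is a coset.\<close>

definition U_star :: "ufree set \<Rightarrow> ufree set" where
  "U_star h = star_free ` h"

fun Delta_gen :: "ugen \<Rightarrow> (ugen list \<times> ugen list) \<Rightarrow>\<^sub>0 complex" where
  "Delta_gen (gE i) = Poly_Mapping.single ([gE i], [gK i]) 1 + Poly_Mapping.single ([gKi i], [gE i]) 1"
| "Delta_gen (gF i) = Poly_Mapping.single ([gF i], [gK i]) 1 + Poly_Mapping.single ([gKi i], [gF i]) 1"
| "Delta_gen g = Poly_Mapping.single ([g], [g]) 1"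

definition U_Delta :: "ufree \<Rightarrow> (ugen list \<times> ugen list) \<Rightarrow>\<^sub>0 complex" where
  "U_Delta = alg_ext scalar Delta_gen"

fun eps_gen :: "ugen \<Rightarrow> complex" where
  "eps_gen (gE i) = 0"
| "eps_gen (gF i) = 0"
| "eps_gen g = 1"

definition eps_free :: "ufree \<Rightarrow> complex" where
  "eps_free = alg_ext id eps_gen"

text \<open>\<^const>\<open>eps_free\<close> is constant on cosets.\<close>

definition U_eps :: "ufree set \<Rightarrow> complex" where
  "U_eps h = the_elem (eps_free ` h)"

definition Usu2 :: "real \<Rightarrow> ufree set set" where
  "Usu2 q = ucl q ` {x. Poly_Mapping.keys x \<subseteq> lists {gK N1, gKi N1, gE N1, gF N1}}"

definition qcomm :: "real \<Rightarrow> ufree \<Rightarrow> ufree \<Rightarrow> ufree" where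
  "qcomm q a b = a * b - scalar (1 / q) * b * a"

definition casimir :: "real \<Rightarrow> ufree set" where
  "casimir q = ucl q (
     scalar (1 / (q - 1 / q)^2) *
       ((H + Hi) * ((scalar q * K N1 * K N2)^2 + (scalar (1 / q) * Ki N2 * Ki N1)^2)
        + H^2 + Hi^2 - 6)
     + (scalar q * H * (K N2)^2 + scalar (1 / q) * Hi * (Ki N2)^2) * F N1 * E N1
     + (scalar q * Hi * (K N1)^2 + scalar (1 / q) * H * (Ki N1)^2) * F N2 * E N2
     + scalar q * H * qcomm q (F N2) (F N1) * qcomm q (E N1) (E N2)
     + scalar q * Hi * qcomm q (F N1) (F N2) * qcomm q (E N2) (E N1))"


section \<open>The coordinate algebra of quantum SU(3)\<close>

text \<open>The type \<^typ>\<open>Enum.finite_3\<close> carries the linear order \<open>a\<^sub>1 < a\<^sub>2 < a\<^sub>3\<close>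
  (unlike the numeral type \<open>3\<close>, where the numeral \<open>3\<close> is \<open>0\<close>).\<close>

type_synonym idx = Enum.finite_3

abbreviation I1 :: idx where "I1 \<equiv> finite_3.a\<^sub>1"
abbreviation I2 :: idx where "I2 \<equiv> finite_3.a\<^sub>2"
abbreviation I3 :: idx where "I3 \<equiv> finite_3.a\<^sub>3"

type_synonym afree = "(idx \<times> idx) list \<Rightarrow>\<^sub>0 complex"

text \<open>\<open>u i j\<close> has upper index (row) \<open>i\<close> and lower index (column) \<open>j\<close>.\<close>

abbreviation u :: "idx \<Rightarrow> idx \<Rightarrow> afree" where "u i j \<equiv> gen (i, j)"

definition perm_length :: "(idx \<Rightarrow> idx) \<Rightarrow> nat" where
  "perm_length p = card {(i, j). i < j \<and> p j < p i}"

definition A_rels :: "real \<Rightarrow> afree set" where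
  "A_rels q =
     (\<Union>(i, j)\<in>{(i, j). i < j}. \<Union>k.
        {u i k * u j k - scalar q * u j k * u i k,
         u k i * u k j - scalar q * u k j * u k i}) \<union>
     (\<Union>(i, j)\<in>{(i, j). i < j}. \<Union>(k, l)\<in>{(k, l). k < l}.
        {u i l * u j k - u j k * u i l,
         (u i k * u j l - u j l * u i k) - scalar (q - 1 / q) * u i l * u j k}) \<union>
     {(\<Sum>p\<in>{p. bij p}. scalar ((- q) ^ perm_length p) * u I1 (p I1) * u I2 (p I2) * u I3 (p I3)) - 1}"

definition ASU3 :: "real \<Rightarrow> afree set ring" where
  "ASU3 q = presented (A_rels q)"

abbreviation acl :: "real \<Rightarrow> afree \<Rightarrow> afree set" where
  "acl q x \<equiv> residue (A_rels q) x"

definition A_scale :: "real \<Rightarrow> complex \<Rightarrow> afree set \<Rightarrow> afree set" where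
  "A_scale q c a = acl q (scalar c) \<otimes>\<^bsub>ASU3 q\<^esub> a"

definition A_Delta :: "afree \<Rightarrow> ((idx \<times> idx) list \<times> (idx \<times> idx) list) \<Rightarrow>\<^sub>0 complex" where
  "A_Delta = alg_ext scalar (\<lambda>(i, j). \<Sum>k\<in>UNIV. Poly_Mapping.single ([(i, k)], [(k, j)]) 1)"


section \<open>The dual pairing and the left action\<close>

definition diag3 :: "complex \<Rightarrow> complex \<Rightarrow> complex \<Rightarrow> complex^idx^idx" where
  "diag3 a b c = (\<chi> i j. if i = j then case_finite_3 a b c i else 0)"

definition munit :: "idx \<Rightarrow> idx \<Rightarrow> complex^idx^idx" where
  "munit r s = (\<chi> i j. if i = r \<and> j = s then 1 else 0)"

fun sigma_gen :: "real \<Rightarrow> ugen \<Rightarrow> complex^idx^idx" where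
  "sigma_gen q (gK N1) = diag3 (q powr (- 1 / 2)) (q powr (1 / 2)) 1"
| "sigma_gen q (gKi N1) = diag3 (q powr (1 / 2)) (q powr (- 1 / 2)) 1"
| "sigma_gen q (gK N2) = diag3 1 (q powr (- 1 / 2)) (q powr (1 / 2))"
| "sigma_gen q (gKi N2) = diag3 1 (q powr (1 / 2)) (q powr (- 1 / 2))"
| "sigma_gen q gH = diag3 (q powr (- 1 / 3)) (q powr (2 / 3)) (q powr (- 1 / 3))"
| "sigma_gen q gHi = diag3 (q powr (1 / 3)) (q powr (- 2 / 3)) (q powr (1 / 3))"
| "sigma_gen q (gE N1) = munit I2 I1"
| "sigma_gen q (gE N2) = munit I3 I2"
| "sigma_gen q (gF N1) = munit I1 I2"
| "sigma_gen q (gF N2) = munit I2 I3"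

definition sigma_word :: "real \<Rightarrow> ugen list \<Rightarrow> complex^idx^idx" where
  "sigma_word q w = foldr (\<lambda>g M. sigma_gen q g ** M) w (mat 1)"

text \<open>
  The pairing is determined by its values \<open>\<langle>h, u i j\<rangle> = \<sigma> i j (h)\<close> together with
  \<open>\<langle>h, 1\<rangle> = \<epsilon>(h)\<close> and \<open>\<langle>h, a b\<rangle> = \<langle>h\<^sub>1, a\<rangle> \<langle>h\<^sub>2, b\<rangle>\<close>, where \<open>\<Delta>(h) = h\<^sub>1 \<otimes> h\<^sub>2\<close>
  (Sweedler); this is the recursion below.
\<close>

primrec pairing_word :: "real \<Rightarrow> (idx \<times> idx) list \<Rightarrow> ufree \<Rightarrow> complex" where
  "pairing_word q [] h = eps_free h"
| "pairing_word q (ij # w) h =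
     (\<Sum>(x, y)\<in>Poly_Mapping.keys (U_Delta h).
        Poly_Mapping.lookup (U_Delta h) (x, y) * (sigma_word q x $ fst ij $ snd ij)
          * pairing_word q w (Poly_Mapping.single y 1))"

definition pairing :: "real \<Rightarrow> ufree \<Rightarrow> afree \<Rightarrow> complex" where
  "pairing q h a =
     (\<Sum>w\<in>Poly_Mapping.keys a. Poly_Mapping.lookup a w * pairing_word q w h)"

text \<open>\<open>h \<triangleright> a = \<langle>\<vartheta>(h), a\<^sub>1\<rangle> a\<^sub>2\<close> on representatives.\<close>

definition act_free :: "real \<Rightarrow> ufree \<Rightarrow> afree \<Rightarrow> afree" where
  "act_free q h a =
     (\<Sum>(v, w)\<in>Poly_Mapping.keys (A_Delta a).
        Poly_Mapping.single w (Poly_Mapping.lookup (A_Delta a) (v, w)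
          * pairing q (theta_free h) (Poly_Mapping.single v 1)))"

text \<open>The relations generate Hopf ideals which pair to zero with the whole of the other algebra, so
  \<^const>\<open>act_free\<close> respects residues, and the union below is a union of equal cosets.\<close>

definition act :: "real \<Rightarrow> ufree set \<Rightarrow> afree set \<Rightarrow> afree set" where
  "act q h a = (\<Union>x\<in>h. \<Union>y\<in>a. acl q (act_free q x y))"


section \<open>Antiholomorphic forms and the Dolbeault operators\<close>

definition AS5 :: "real \<Rightarrow> afree set set" where
  "AS5 q = {a \<in> carrier (ASU3 q). \<forall>h\<in>Usu2 q. act q h a = A_scale q (U_eps h) a}"

definition LN :: "real \<Rightarrow> int \<Rightarrow> afree set set" where
  "LN q N = {a \<in> AS5 q. act q (ucl q (K N1 * (K N2)^2)) a = A_scale q (q powi N) a}"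

definition Omega00 :: "real \<Rightarrow> afree set set" where
  "Omega00 q = LN q 0"

definition Omega02 :: "real \<Rightarrow> afree set set" where
  "Omega02 q = LN q 3"

definition Omega01 :: "real \<Rightarrow> (afree set \<times> afree set) set" where
  "Omega01 q = {(vp, vm). vp \<in> carrier (ASU3 q) \<and> vm \<in> carrier (ASU3 q) \<and>
     act q (ucl q (K N1 * (K N2)^2)) vp = A_scale q (q powr (3 / 2)) vp \<and>
     act q (ucl q (K N1 * (K N2)^2)) vm = A_scale q (q powr (3 / 2)) vm \<and>
     act q (ucl q (K N1)) vp = A_scale q (q powr (1 / 2)) vp \<and>
     act q (ucl q (K N1)) vm = A_scale q (q powr (- 1 / 2)) vm \<and>
     act q (ucl q (E N1)) vp = \<zero>\<^bsub>ASU3 q\<^esub> \<and>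
     act q (ucl q (E N1)) vm = vp \<and>
     act q (ucl q (F N1)) vp = vm \<and>
     act q (ucl q (F N1)) vm = \<zero>\<^bsub>ASU3 q\<^esub>}"

type_synonym form = "afree set \<times> (afree set \<times> afree set) \<times> afree set"

definition Omega :: "real \<Rightarrow> form set" where
  "Omega q = Omega00 q \<times> Omega01 q \<times> Omega02 q"

definition Xel :: "real \<Rightarrow> ufree set" where
  "Xel q = ucl q (F N2 * F N1 - scalar (2 / qnum q 2) * F N1 * F N2)"

definition Yel :: "real \<Rightarrow> ufree set" where
  "Yel q = ucl q (E N2 * E N1 - scalar (2 / qnum q 2) * E N1 * E N2)"

definition dbar0 :: "real \<Rightarrow> afree set \<Rightarrow> afree set \<times> afree set" where
  "dbar0 q a = (act q (U_star (Xel q)) a, act q (ucl q (E N2)) a)"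

definition dbar1 :: "real \<Rightarrow> afree set \<times> afree set \<Rightarrow> afree set" where
  "dbar1 q = (\<lambda>(vp, vm).
     (\<ominus>\<^bsub>ASU3 q\<^esub> act q (ucl q (E N2)) vp) \<ominus>\<^bsub>ASU3 q\<^esub> act q (Yel q) vm)"

definition dbar_dag1 :: "real \<Rightarrow> afree set \<times> afree set \<Rightarrow> afree set" where
  "dbar_dag1 q = (\<lambda>(vp, vm). act q (Xel q) vp \<oplus>\<^bsub>ASU3 q\<^esub> act q (ucl q (F N2)) vm)"

definition dbar_dag2 :: "real \<Rightarrow> afree set \<Rightarrow> afree set \<times> afree set" where
  "dbar_dag2 q b =
     (\<ominus>\<^bsub>ASU3 q\<^esub> act q (ucl q (F N2)) b, \<ominus>\<^bsub>ASU3 q\<^esub> act q (U_star (Yel q)) b)"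

definition Dirac :: "real \<Rightarrow> real \<Rightarrow> form \<Rightarrow> form" where
  "Dirac q s = (\<lambda>(a, v, b).
     (dbar_dag1 q v,
      (fst (dbar0 q a) \<oplus>\<^bsub>ASU3 q\<^esub> A_scale q s (fst (dbar_dag2 q b)),
       snd (dbar0 q a) \<oplus>\<^bsub>ASU3 q\<^esub> A_scale q s (snd (dbar_dag2 q b))),
      A_scale q s (dbar1 q v)))"

definition comp_act :: "real \<Rightarrow> ufree set \<Rightarrow> form \<Rightarrow> form" where
  "comp_act q h = (\<lambda>(a, (vp, vm), b). (act q h a, (act q h vp, act q h vm), act q h b))"

definition comp_scale :: "real \<Rightarrow> complex \<Rightarrow> form \<Rightarrow> form" where
  "comp_scale q c = (\<lambda>(a, (vp, vm), b).
     (A_scale q c a, (A_scale q c vp, A_scale q c vm), A_scale q c b))"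

end

(*
  The relations of U_q(su(3)) are seen to act as zero on the free algebra by induction on words, and
  the generators map the ideal of relations of A(SU_q(3)) to itself, so the action descends to the
  quotients. On forms, D^2 is then computed in terms of the operators E_i, F_i by moving the F_i to
  the left of the E_i: the components of forms are eigenvectors of K_1, K_2^2 and H, so commutators
  [E_i, F_i] are scalars, and invariance and the Serre relations remove all but a few monomials. The
  Casimir element is brought to the same normal form. The eigenvalue of H is not part of the
  definition of forms; it is determined by H^3 = (K_1 K_2^{-1})^2, since H has only positive
  eigenvalues on words.
*)
theory Submission
  imports Defs
begin

section \<open>Linear maps on free algebras\<close>

text \<open>\<open>act\<close> is a union over all pairs of representatives, so nothing can be
  computed with it before both ideals are known to be respected. After the descent,
  \<open>nf\<close> replaces each coset by one representative, linearly; only the kernel of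
  \<open>nf\<close> matters and no basis of the quotient is computed. For \<open>Usu2 q\<close> the
  components of forms are singlets or doublets, and the commutators of \<open>E i\<close> and
  \<open>F i\<close> on them are q-numbers. The coefficient 2/[2] in X and Y has two effects: it
  makes the antiholomorphic differential square to zero by the Serre relations, and it selects
  singlets when a doublet is mapped to degree 0 or 2. With it fixed, s^2 = [2]/2 gives the two
  halves of D^2 on (0,1)-forms the relative weight that the Casimir element has.\<close>

definition smul :: "complex \<Rightarrow> ('m::monoid_add \<Rightarrow>\<^sub>0 complex) \<Rightarrow> ('m \<Rightarrow>\<^sub>0 complex)" (infixr "*\<^sub>c" 75)
  where "c *\<^sub>c x = scalar c * x"

lemma lookup_smul: "Poly_Mapping.lookup (c *\<^sub>c x) k = c * Poly_Mapping.lookup x k"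
  by (simp add: smul_def scalar_def mult_map_scale_conv_mult[symmetric] Poly_Mapping.map.rep_eq when_def)

lemma poly_mapping_add_induct [case_names single add]:
  assumes single: "\<And>k c. P (Poly_Mapping.single k c)"
    and add: "\<And>x y. P x \<Longrightarrow> P y \<Longrightarrow> P (x + y)"
  shows "P (x :: 'k \<Rightarrow>\<^sub>0 'c::ab_group_add)"
proof (induction x rule: update_induct)
  case const
  show ?case using single[of undefined 0] by simp
next
  case (update f a b)
  have "Poly_Mapping.update a b f = Poly_Mapping.single a b + f"
    using update.hyps
    by (intro poly_mapping_eqI) (auto simp: lookup_update lookup_add lookup_single when_def in_keys_iff)
  then show ?case using add single update by metis
qed

lemma smul_single: "c *\<^sub>c Poly_Mapping.single k d = Poly_Mapping.single k (c * d)"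
  by (rule poly_mapping_eqI) (simp add: lookup_smul lookup_single when_def)

lemma scalar_alt: "scalar c = c *\<^sub>c 1"
  by (simp add: smul_def)

lemma smul_mult_left: "(c *\<^sub>c x) * y = c *\<^sub>c (x * y)"
  by (simp add: smul_def mult.assoc)

text \<open>Scalars multiply from the left by definition, so the left-hand rule is mere
  associativity, while this one says that scalars are central. It reduces to pairs of single words,
  where coefficients commute.\<close>

lemma smul_mult_right: "x * (c *\<^sub>c y) = c *\<^sub>c (x * y)"
proof (induction x rule: poly_mapping_add_induct)
  case (single k d)
  show ?case
    by (induction y rule: poly_mapping_add_induct)
      (simp_all add: smul_single mult_single smul_def[of c "_ + _"] distrib_left smul_def[symmetric] mult_ac)
next
  case (add x y)
  then show ?case by (simp add: distrib_right) (simp add: smul_def distrib_left)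
qed

lemma smul_smul [simp]: "c *\<^sub>c d *\<^sub>c x = (c * d) *\<^sub>c x"
  by (rule poly_mapping_eqI) (simp add: lookup_smul)

lemma smul_one [simp]: "1 *\<^sub>c x = x"
  and smul_zero_left [simp]: "0 *\<^sub>c x = 0"
  and smul_zero [simp]: "c *\<^sub>c 0 = 0"
  and smul_minus_left: "(- c) *\<^sub>c x = - (c *\<^sub>c x)"
  and smul_minus: "c *\<^sub>c (- x) = - (c *\<^sub>c x)"
  and smul_add_left: "(c + d) *\<^sub>c x = c *\<^sub>c x + d *\<^sub>c x"
  and smul_add: "c *\<^sub>c (x + y) = c *\<^sub>c x + c *\<^sub>c y"
  and smul_diff_left: "(c - d) *\<^sub>c x = c *\<^sub>c x - d *\<^sub>c x"
  and smul_diff: "c *\<^sub>c (x - y) = c *\<^sub>c x - c *\<^sub>c y"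
  by (rule poly_mapping_eqI; simp add: lookup_smul lookup_add lookup_minus algebra_simps)+

lemma scalar_mult: "scalar c * x = c *\<^sub>c x"
  by (simp add: smul_def)

interpretation cvs: vector_space smul
  by standard (simp_all add: smul_add smul_add_left)

lemma numeral_alt: "(numeral n :: 'm::monoid_add \<Rightarrow>\<^sub>0 complex) = numeral n *\<^sub>c 1"
  by (rule poly_mapping_eqI) (simp add: lookup_smul lookup_numeral lookup_one when_def)

text \<open>Common shape of the sums over \<open>keys\<close>. The value at a basis element may
  depend on the coefficient in any additive way, so the conjugate-linear \<open>star_free\<close> is
  covered along with the linear maps.\<close>

definition lin_ext :: "('k \<Rightarrow> complex \<Rightarrow> 'b::ab_group_add) \<Rightarrow> ('k \<Rightarrow>\<^sub>0 complex) \<Rightarrow> 'b" where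
  "lin_ext \<phi> x = (\<Sum>k\<in>Poly_Mapping.keys x. \<phi> k (Poly_Mapping.lookup x k))"

lemma lin_ext_single:
  assumes "\<And>k c d. \<phi> k (c + d) = \<phi> k c + \<phi> k d"
  shows "lin_ext \<phi> (Poly_Mapping.single k c) = \<phi> k c"
proof -
  have "\<phi> k 0 = 0" using assms[of k 0 0] by simp
  then show ?thesis by (simp add: lin_ext_def)
qed

lemma lin_ext_add:
  assumes "\<And>k c d. \<phi> k (c + d) = \<phi> k c + \<phi> k d"
  shows "lin_ext \<phi> (x + y) = lin_ext \<phi> x + lin_ext \<phi> y"
proof -
  have 0: "\<phi> k 0 = 0" for k using assms[of k 0 0] by simp
  \<comment> \<open>Cancellation can make the support of \<open>x + y\<close> smaller than this
    union, so all three sums are taken over the union.\<close>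
  define S where "S = Poly_Mapping.keys x \<union> Poly_Mapping.keys y"
  have S: "lin_ext \<phi> z = (\<Sum>k\<in>S. \<phi> k (Poly_Mapping.lookup z k))" if "Poly_Mapping.keys z \<subseteq> S" for z
    unfolding lin_ext_def
    by (rule sum.mono_neutral_left) (use that 0 in \<open>auto simp: S_def in_keys_iff\<close>)
  have "Poly_Mapping.keys (x + y) \<subseteq> S" unfolding S_def by (rule keys_add)
  then show ?thesis
    by (simp add: S) (simp add: S_def S[unfolded S_def] lookup_add assms sum.distrib)
qed

lemma additive_eqI:
  fixes f g :: "('k \<Rightarrow>\<^sub>0 complex) \<Rightarrow> 'b::ab_group_add"
  assumes "\<And>x y. f (x + y) = f x + f y" "\<And>x y. g (x + y) = g x + g y"
    and "\<And>k c. f (Poly_Mapping.single k c) = g (Poly_Mapping.single k c)"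
  shows "f x = g x"
  by (induction x rule: poly_mapping_add_induct) (simp_all add: assms)

lemma single_Cons: "Poly_Mapping.single (g # w) c = gen g * Poly_Mapping.single w c"
  by (simp add: gen_def mult_single plus_list_def)

lemma single_Nil: "Poly_Mapping.single [] c = scalar c"
  by (simp add: scalar_def zero_list_def)

lemma free_algebra_induct [case_names scalar gen add]:
  assumes "\<And>c. P (scalar c)" "\<And>g x. P x \<Longrightarrow> P (gen g * x)" "\<And>x y. P x \<Longrightarrow> P y \<Longrightarrow> P (x + y)"
  shows "P (x :: 'g list \<Rightarrow>\<^sub>0 complex)"
proof (induction x rule: poly_mapping_add_induct)
  case (single k c)
  show ?case by (induction k) (simp_all add: assms single_Nil single_Cons)
qed (rule assms)

lemma alg_ext_lin_ext: "alg_ext \<iota> f = lin_ext (\<lambda>w c. \<iota> c * prod_list (map f w))"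
  by (simp add: fun_eq_iff alg_ext_def lin_ext_def)

text \<open>Centrality lets coefficients pass the images of words, which makes
  \<open>alg_ext\<close> multiplicative. The instance \<open>scalar\<close> serves the coproducts,
  the instance \<open>id\<close> the counit.\<close>

locale central_scalars =
  fixes \<iota> :: "complex \<Rightarrow> 'r::ring_1"
  assumes iota_add: "\<iota> (c + d) = \<iota> c + \<iota> d" and iota_mult: "\<iota> (c * d) = \<iota> c * \<iota> d"
    and iota_1: "\<iota> 1 = 1" and iota_central: "\<iota> c * y = y * \<iota> c"
begin

lemma alg_ext_add: "alg_ext \<iota> f (x + y) = alg_ext \<iota> f x + alg_ext \<iota> f y"
  unfolding alg_ext_lin_ext by (rule lin_ext_add) (simp add: iota_add distrib_right)

lemma alg_ext_single: "alg_ext \<iota> f (Poly_Mapping.single w c) = \<iota> c * prod_list (map f w)"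
  unfolding alg_ext_lin_ext by (rule lin_ext_single) (simp add: iota_add distrib_right)

lemma alg_ext_mult: "alg_ext \<iota> f (x * y) = alg_ext \<iota> f x * alg_ext \<iota> f y"
proof (induction x rule: poly_mapping_add_induct)
  case (single v c)
  show ?case
  proof (induction y rule: poly_mapping_add_induct)
    case (single w d)
    have "\<iota> c * (\<iota> d * (x * y)) = \<iota> c * (x * (\<iota> d * y))" for x y
      by (metis iota_central mult.assoc)
    then show ?case by (simp add: mult_single alg_ext_single plus_list_def iota_mult mult.assoc)
  qed (simp add: distrib_left alg_ext_add)
qed (simp add: distrib_right alg_ext_add)

lemma alg_ext_gen: "alg_ext \<iota> f (gen g) = f g"
  by (simp add: gen_def alg_ext_single iota_1)

lemma alg_ext_scalar: "alg_ext \<iota> f (scalar c) = \<iota> c"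
  by (simp add: single_Nil[symmetric] alg_ext_single)

end

interpretation scalar: central_scalars "scalar :: complex \<Rightarrow> 'm::monoid_add \<Rightarrow>\<^sub>0 complex"
proof
  show "scalar c * y = y * scalar c" for c and y :: "'m \<Rightarrow>\<^sub>0 complex"
    using smul_mult_right[of y c 1] by (simp add: smul_def)
qed (simp_all add: scalar_def single_add mult_single)

interpretation id: central_scalars "id :: complex \<Rightarrow> complex"
  by standard simp_all

text \<open>The map \<open>f\<close> stands for multiplication by \<open>c\<close>, or by its
  conjugate in the case of \<open>star_free\<close>.\<close>

lemma lin_ext_smul:
  assumes "\<And>k c d. \<phi> k (c + d) = \<phi> k c + \<phi> k d"
    and "\<And>k d. \<phi> k (c * d) = f (\<phi> k d)" and "\<And>x y. f (x + y) = f x + f y"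
  shows "lin_ext \<phi> (c *\<^sub>c x) = f (lin_ext \<phi> x)"
  by (induction x rule: poly_mapping_add_induct)
    (simp_all add: smul_add smul_single lin_ext_single lin_ext_add assms)

lemma lin_ext_add_fun: "lin_ext (\<lambda>k c. \<phi> k c + \<psi> k c) x = lin_ext \<phi> x + lin_ext \<psi> x"
  by (simp add: lin_ext_def sum.distrib)

section \<open>Multiplicativity of the action on the free algebra\<close>

lemma theta_free_lin_ext: "theta_free = lin_ext (\<lambda>w. Poly_Mapping.single (rev (map swap_gen w)))"
  by (simp add: fun_eq_iff theta_free_def lin_ext_def)

lemma star_free_lin_ext:
  "star_free = lin_ext (\<lambda>w c. Poly_Mapping.single (rev (map swap_gen w)) (cnj c))"
  by (simp add: fun_eq_iff star_free_def lin_ext_def)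

lemma theta_free_add: "theta_free (x + y) = theta_free x + theta_free y"
  unfolding theta_free_lin_ext by (rule lin_ext_add) (simp add: single_add)

lemma theta_free_single: "theta_free (Poly_Mapping.single w c) = Poly_Mapping.single (rev (map swap_gen w)) c"
  unfolding theta_free_lin_ext by (rule lin_ext_single) (simp add: single_add)

lemma theta_free_mult: "theta_free (x * y) = theta_free y * theta_free x"
proof (induction x rule: poly_mapping_add_induct)
  case (single v c)
  show ?case
    by (induction y rule: poly_mapping_add_induct)
      (simp_all add: distrib_left distrib_right theta_free_add theta_free_single mult_single plus_list_def mult.commute)
qed (simp add: distrib_left distrib_right theta_free_add)

lemma theta_free_gen: "theta_free (gen g) = gen (swap_gen g)"
  by (simp add: gen_def theta_free_single)

lemma star_free_add: "star_free (x + y) = star_free x + star_free y"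
  unfolding star_free_lin_ext by (rule lin_ext_add) (simp add: single_add)

lemma star_free_single:
  "star_free (Poly_Mapping.single w c) = Poly_Mapping.single (rev (map swap_gen w)) (cnj c)"
  unfolding star_free_lin_ext by (rule lin_ext_single) (simp add: single_add)

lemma star_free_mult: "star_free (x * y) = star_free y * star_free x"
proof (induction x rule: poly_mapping_add_induct)
  case (single v c)
  show ?case
    by (induction y rule: poly_mapping_add_induct)
      (simp_all add: distrib_left distrib_right star_free_add star_free_single mult_single plus_list_def mult.commute)
qed (simp add: distrib_left distrib_right star_free_add)

lemma star_free_gen: "star_free (gen g) = gen (swap_gen g)"
  by (simp add: gen_def star_free_single)

lemma star_free_smul: "star_free (c *\<^sub>c x) = cnj c *\<^sub>c star_free x"
  unfolding star_free_lin_ext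
  by (rule lin_ext_smul) (simp_all add: single_add smul_single smul_add)

lemma star_free_scalar: "star_free (scalar c) = scalar (cnj c)"
  by (simp add: single_Nil[symmetric] star_free_single)

lemma star_free_one: "star_free 1 = 1"
  using star_free_scalar[of 1] by (simp add: scalar_alt)

lemma star_free_zero: "star_free 0 = 0"
  by (simp add: star_free_def)

lemma star_free_diff: "star_free (x - y) = star_free x - star_free y"
  by (metis diff_add_cancel eq_diff_eq star_free_add)

lemma swap_gen_swap_gen [simp]: "swap_gen (swap_gen g) = g"
  by (cases g) simp_all

lemma star_free_star_free [simp]: "star_free (star_free x) = x"
proof (induction x rule: poly_mapping_add_induct)
  case (single k c)
  have "map (swap_gen \<circ> swap_gen) k = k" by (induction k) simp_all
  then show ?case by (simp add: star_free_single rev_map)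
qed (simp add: star_free_add)

lemma eps_free_simps:
  "eps_free (x + y) = eps_free x + eps_free y" "eps_free (x * y) = eps_free x * eps_free y"
  "eps_free (gen g) = eps_gen g" "eps_free (scalar c) = c"
  by (simp_all add: eps_free_def id.alg_ext_add id.alg_ext_mult id.alg_ext_gen id.alg_ext_scalar)

lemma eps_free_smul: "eps_free (c *\<^sub>c x) = c * eps_free x"
  by (simp add: smul_def eps_free_simps)

lemma U_Delta_simps:
  "U_Delta (x + y) = U_Delta x + U_Delta y" "U_Delta (x * y) = U_Delta x * U_Delta y"
  "U_Delta (gen g) = Delta_gen g" "U_Delta (scalar c) = scalar c"
  by (simp_all add: U_Delta_def scalar.alg_ext_add scalar.alg_ext_mult scalar.alg_ext_gen scalar.alg_ext_scalar)

lemma U_Delta_smul: "U_Delta (c *\<^sub>c x) = c *\<^sub>c U_Delta x"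
  by (simp add: smul_def U_Delta_simps)

lemma A_Delta_simps:
  "A_Delta (x + y) = A_Delta x + A_Delta y" "A_Delta (x * y) = A_Delta x * A_Delta y"
  "A_Delta (u i j) = (\<Sum>k\<in>UNIV. Poly_Mapping.single ([(i, k)], [(k, j)]) 1)" "A_Delta (scalar c) = scalar c"
  by (simp_all add: A_Delta_def scalar.alg_ext_add scalar.alg_ext_mult scalar.alg_ext_gen scalar.alg_ext_scalar)

lemma pairing_word_Cons:
  "pairing_word q (ij # w) h = lin_ext (\<lambda>(x, y) c. c * (sigma_word q x $ fst ij $ snd ij)
     * pairing_word q w (Poly_Mapping.single y 1)) (U_Delta h)"
  by (simp add: lin_ext_def split_def)

lemma pairing_word_add: "pairing_word q w (x + y) = pairing_word q w x + pairing_word q w y"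
proof (cases w)
  case Nil
  then show ?thesis by (simp add: eps_free_simps)
next
  case (Cons ij v)
  show ?thesis
    unfolding Cons pairing_word_Cons U_Delta_simps by (rule lin_ext_add) (auto simp: algebra_simps)
qed

lemma pairing_word_smul: "pairing_word q w (c *\<^sub>c x) = c * pairing_word q w x"
proof (cases w)
  case Nil
  then show ?thesis by (simp add: eps_free_smul)
next
  case (Cons ij v)
  show ?thesis
    unfolding Cons pairing_word_Cons U_Delta_smul by (rule lin_ext_smul) (auto simp: algebra_simps)
qed

lemma pairing_single: "pairing q h (Poly_Mapping.single v c) = c * pairing_word q v h"
  by (simp add: pairing_def)

text \<open>The action with \<^const>\<open>theta_free\<close> stripped off is a right action.\<close>

definition ract :: "real \<Rightarrow> ufree \<Rightarrow> afree \<Rightarrow> afree" where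
  "ract q h a = lin_ext (\<lambda>(v, w) c. Poly_Mapping.single w (c * pairing_word q v h)) (A_Delta a)"

lemma act_free_ract: "act_free q h a = ract q (theta_free h) a"
  by (simp add: act_free_def ract_def lin_ext_def pairing_single split_def)

lemma ract_add: "ract q h (a + b) = ract q h a + ract q h b"
  unfolding ract_def A_Delta_simps by (rule lin_ext_add) (auto simp: single_add algebra_simps)

lemma ract_smul: "ract q h (c *\<^sub>c a) = c *\<^sub>c ract q h a"
proof -
  have "A_Delta (c *\<^sub>c a) = c *\<^sub>c A_Delta a" by (simp add: smul_def A_Delta_simps)
  then show ?thesis
    unfolding ract_def
    by simp (rule lin_ext_smul, auto simp: single_add smul_single smul_add algebra_simps)
qed

lemma ract_add_left: "ract q (g + h) a = ract q g a + ract q h a"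
  unfolding ract_def lin_ext_add_fun[symmetric]
  by (simp add: pairing_word_add single_add distrib_left split_def)

lemma ract_smul_left: "ract q (c *\<^sub>c h) a = c *\<^sub>c ract q h a"
proof -
  have "ract q (c *\<^sub>c h) a = lin_ext (\<lambda>(v, w) d. Poly_Mapping.single w (d * pairing_word q v h)) (c *\<^sub>c A_Delta a)"
    unfolding ract_def pairing_word_smul
    by (rule sym, subst lin_ext_smul[where f = "\<lambda>x. c *\<^sub>c x"])
      (auto simp: single_add smul_single smul_add algebra_simps lin_ext_def cvs.scale_sum_right split_def intro!: sum.cong)
  also have "\<dots> = c *\<^sub>c ract q h a"
    unfolding ract_def
    by (rule lin_ext_smul) (auto simp: single_add smul_single smul_add algebra_simps)
  finally show ?thesis .
qed

lemma ract_scalar: "ract q h (scalar c) = scalar (c * eps_free h)"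
proof -
  have *: "scalar c = Poly_Mapping.single ([], []) c"
    by (simp add: scalar_def zero_prod_def zero_list_def)
  show ?thesis
    unfolding ract_def A_Delta_simps *
    by (subst lin_ext_single) (auto simp: single_add algebra_simps single_Nil)
qed

text \<open>For a tensor with legs \<open>x\<close> and \<open>y\<close>, the leg \<open>x\<close>
  acts on the generator through row \<open>i\<close> of its matrix and \<open>y\<close> acts on
  \<open>a\<close>. At the coproduct of \<open>h\<close> this is the module-algebra rule for
  \<open>h\<close> on \<open>u i j * a\<close>.\<close>

definition ract_tensor where
  "ract_tensor q i j a = lin_ext (\<lambda>(x, y) c.
     \<Sum>k\<in>UNIV. (c * (sigma_word q x $ i $ k)) *\<^sub>c (u k j * ract q (Poly_Mapping.single y 1) a))"

lemma ract_tensor_add: "ract_tensor q i j a (s + t) = ract_tensor q i j a s + ract_tensor q i j a t"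
  unfolding ract_tensor_def
  by (rule lin_ext_add) (auto simp: distrib_right smul_add_left sum.distrib)

lemma ract_tensor_single: "ract_tensor q i j a (Poly_Mapping.single (x, y) c) =
   (\<Sum>k\<in>UNIV. (c * (sigma_word q x $ i $ k)) *\<^sub>c (u k j * ract q (Poly_Mapping.single y 1) a))"
  unfolding ract_tensor_def
  by (subst lin_ext_single) (auto simp: distrib_right smul_add_left sum.distrib)

text \<open>\<open>pairing_word\<close> pairs the first letter of a word with the first leg of the
  coproduct, which leaves the second leg to act on the rest.\<close>

lemma ract_Cons: "ract q h (u i j * a) = ract_tensor q i j a (U_Delta h)"
proof -
  define R :: "ufree \<Rightarrow> ((idx \<times> idx) list \<times> (idx \<times> idx) list \<Rightarrow>\<^sub>0 complex) \<Rightarrow> afree"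
    where "R h = lin_ext (\<lambda>(v, w) c. Poly_Mapping.single w (c * pairing_word q v h))" for h
  have R_add: "R h (s + t) = R h s + R h t" for h s t
    unfolding R_def by (rule lin_ext_add) (auto simp: single_add algebra_simps)
  have R_single: "R h (Poly_Mapping.single (v, w) c) = Poly_Mapping.single w (c * pairing_word q v h)" for h v w c
    unfolding R_def by (subst lin_ext_single) (auto simp: single_add algebra_simps)
  have R_sum: "R h (sum f S) = (\<Sum>k\<in>S. R h (f k))" if "finite S" for h f and S :: "idx set"
    using that by (induction S rule: finite_induct) (simp_all add: R_add, simp add: R_def lin_ext_def)
  \<comment> \<open>An arbitrary tensor \<open>t\<close> takes the place of
    \<open>A_Delta a\<close>, so that induction over elementary tensors is available.\<close>
  have "R h ((\<Sum>k\<in>UNIV. Poly_Mapping.single ([(i, k)], [(k, j)]) 1) * t) =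
      lin_ext (\<lambda>(x, y) c. \<Sum>k\<in>UNIV. (c * (sigma_word q x $ i $ k)) *\<^sub>c
        (u k j * R (Poly_Mapping.single y 1) t)) (U_Delta h)" (is "?lhs t = ?rhs t") for t
  proof (induction t rule: poly_mapping_add_induct)
    case (single vw c)
    obtain v w where vw: "vw = (v, w)" by fastforce
    have "(\<Sum>k\<in>UNIV. Poly_Mapping.single ((k, j) # w) (c * lin_ext (\<lambda>(x, y) c. c * (sigma_word q x $ i $ k)
     * pairing_word q v (Poly_Mapping.single y 1)) z)) = lin_ext (\<lambda>(x, y) d. \<Sum>k\<in>UNIV. (d * (sigma_word q x $ i $ k)) *\<^sub>c
        (u k j * R (Poly_Mapping.single y 1) (Poly_Mapping.single vw c))) z" (is "?L z = ?R z") for z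
    proof (rule additive_eqI[of ?L ?R])
      have *: "lin_ext (\<lambda>(x, y) c. c * (sigma_word q x $ i $ k) * pairing_word q v (Poly_Mapping.single y 1)) (s + t)
        = lin_ext (\<lambda>(x, y) c. c * (sigma_word q x $ i $ k) * pairing_word q v (Poly_Mapping.single y 1)) s
        + lin_ext (\<lambda>(x, y) c. c * (sigma_word q x $ i $ k) * pairing_word q v (Poly_Mapping.single y 1)) t" for k s t
        by (rule lin_ext_add) (auto simp: algebra_simps)
      show "?L (s + t) = ?L s + ?L t" for s t
        by (simp add: * single_add distrib_left sum.distrib)
      show "?R (s + t) = ?R s + ?R t" for s t
        by (rule lin_ext_add) (auto simp: distrib_right smul_add_left sum.distrib)
      show "?L (Poly_Mapping.single xy d) = ?R (Poly_Mapping.single xy d)" for xy d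
        by (cases xy, simp, (subst lin_ext_single, force simp: distrib_right smul_add_left sum.distrib)+,
            simp add: vw R_single gen_def mult_single plus_list_def smul_single mult_ac)
    qed
    then show ?case
      by (simp add: sum_distrib_right mult_single plus_list_def R_sum R_single vw pairing_word_Cons del: pairing_word.simps)
  next
    case (add s t)
    have "?rhs (s + t) = ?rhs s + ?rhs t"
      unfolding lin_ext_add_fun[symmetric]
      by (rule arg_cong[where f = "\<lambda>\<phi>. lin_ext \<phi> _"])
        (simp add: fun_eq_iff R_add distrib_left smul_add sum.distrib)
    then show ?case using add by (simp only: distrib_left R_add)
  qed
  from this[of "A_Delta a"] show ?thesis
    by (simp add: ract_def ract_tensor_def A_Delta_simps R_def)
qed

text \<open>One letter of \<open>a\<close> is treated at a time: \<open>sigma_word\<close> is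
  multiplicative on first legs, and the induction hypothesis handles second legs. \<open>g\<close>
  is generalized because the second leg in the coproduct of \<open>E\<close> or \<open>F\<close> may
  be \<open>K\<close>, and \<open>y\<close> because it is replaced by its own second legs.\<close>

lemma ract_gen_mult: "ract q (gen g * y) a = ract q y (ract q (gen g) a)"
proof (induction a arbitrary: g y rule: free_algebra_induct)
  case (scalar c)
  show ?case by (simp add: ract_scalar eps_free_simps mult_ac)
next
  case (gen ij a)
  obtain i j where ij: "ij = (i, j)" by fastforce
  have ract_sum: "ract q h (sum f S) = (\<Sum>k\<in>S. ract q h (f k))" if "finite S" for h f and S :: "idx set"
    using that
    by (induction S rule: finite_induct) (simp_all add: ract_add, simp add: ract_def lin_ext_def A_Delta_def alg_ext_def)
  have *: "ract_tensor q i j a (Poly_Mapping.single ([g'], [g'']) 1 * z) =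
     (\<Sum>m\<in>UNIV. (sigma_gen q g' $ i $ m) *\<^sub>c ract_tensor q m j (ract q (gen g'') a) z)" for g' g'' z
  proof (induction z rule: poly_mapping_add_induct)
    case (single xy c)
    obtain x y where xy: "xy = (x, y)" by fastforce
    have "Poly_Mapping.single (g'' # y) 1 = gen g'' * Poly_Mapping.single y 1" by (rule single_Cons)
    moreover have "sigma_word q (g' # x) $ i $ k = (\<Sum>m\<in>UNIV. sigma_gen q g' $ i $ m * sigma_word q x $ m $ k)" for k
      by (simp add: sigma_word_def matrix_matrix_mult_def)
    ultimately show ?case
      by (simp add: xy mult_single plus_list_def ract_tensor_single gen.IH cvs.scale_sum_right cvs.scale_sum_left
          sum_distrib_left mult_ac) (rule sum.swap)
  qed (simp add: distrib_left ract_tensor_add sum.distrib smul_add)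
  have **: "ract q (gen g) (u i j * a) = ract_tensor q i j a (Delta_gen g)" for g
    by (simp add: ract_Cons U_Delta_simps)
  have ***: "ract_tensor q i j a (Poly_Mapping.single ([g'], [g'']) 1) =
     (\<Sum>m\<in>UNIV. (sigma_gen q g' $ i $ m) *\<^sub>c (u m j * ract q (gen g'') a))" for g' g''
    by (simp add: ract_tensor_single sigma_word_def gen_def)
  show ?case
    unfolding ij
    by (cases g)
      (simp_all add: ** ract_Cons[of _ "_ * _"] U_Delta_simps distrib_right ract_tensor_add * *** ract_add ract_sum ract_smul
        ract_Cons[of _ y])
next
  case (add a b)
  then show ?case by (simp add: ract_add)
qed

lemma act_free_add: "act_free q h (a + b) = act_free q h a + act_free q h b"
  and act_free_smul: "act_free q h (c *\<^sub>c a) = c *\<^sub>c act_free q h a"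
  and act_free_add_left: "act_free q (g + h) a = act_free q g a + act_free q h a"
  and act_free_scalar: "act_free q h (scalar c) = scalar (c * eps_free (theta_free h))"
  by (simp_all add: act_free_ract ract_add ract_smul theta_free_add ract_add_left ract_scalar)

lemma act_free_smul_left: "act_free q (c *\<^sub>c h) a = c *\<^sub>c act_free q h a"
proof -
  have "theta_free (c *\<^sub>c h) = c *\<^sub>c theta_free h"
    by (simp add: smul_def theta_free_mult single_Nil[symmetric] theta_free_single)
      (simp add: single_Nil scalar.iota_central[of c])
  then show ?thesis by (simp add: act_free_ract ract_smul_left)
qed

lemma act_free_zero: "act_free q h 0 = 0"
  and act_free_zero_left: "act_free q 0 a = 0"
  using act_free_smul[of q h 0 0] act_free_smul_left[of q 0 0 a] by simp_all

lemma act_free_minus: "act_free q h (- a) = - act_free q h a"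
  and act_free_minus_left: "act_free q (- h) a = - act_free q h a"
  using act_free_smul[of q h "-1" a] act_free_smul_left[of q "-1" h a] by (simp_all add: smul_minus_left)

lemma act_free_diff: "act_free q h (a - b) = act_free q h a - act_free q h b"
  and act_free_diff_left: "act_free q (g - h) a = act_free q g a - act_free q h a"
  using act_free_add[of q h a "- b"] act_free_add_left[of q g "- h" a]
  by (simp_all add: act_free_minus act_free_minus_left)

lemma ract_one: "ract q 1 a = a"
proof (induction a rule: free_algebra_induct)
  case (scalar c)
  have "eps_free 1 = 1" using eps_free_simps(4)[of 1] by (simp add: scalar_alt)
  then show ?case by (simp add: ract_scalar)
next
  case (gen ij a)
  obtain i j where ij: "ij = (i, j)" by fastforce
  have 1: "U_Delta 1 = Poly_Mapping.single ([], []) 1"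
    using U_Delta_simps(4)[of 1] unfolding scalar_alt smul_one
    by (simp only: single_one[symmetric] zero_prod_def zero_list_def)
  have 2: "Poly_Mapping.single [] 1 = (1 :: ufree)"
    by (simp add: single_Nil scalar_alt)
  have "(mat 1 $ i $ k) *\<^sub>c b = (if k = i then b else 0)" for k and b :: afree
    by (simp add: mat_def)
  then show ?case unfolding ij
    by (simp add: ract_Cons 1 ract_tensor_single sigma_word_def 2 gen)
qed (simp add: ract_add)

lemma act_free_one: "act_free q 1 a = a"
proof -
  have "theta_free 1 = 1"
    using theta_free_single[of "[]" 1] by (simp add: single_Nil scalar_alt)
  then show ?thesis by (simp add: act_free_ract ract_one)
qed

text \<open>\<open>theta_free\<close> reverses products and so turns the right action
  \<open>ract\<close> into a left action. The rule for \<open>ract\<close> splits off the last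
  letter of a product, so the letters of \<open>h\<close> are moved over one by one.\<close>

lemma act_free_mult: "act_free q (g * h) a = act_free q g (act_free q h a)"
proof (induction h arbitrary: g a rule: free_algebra_induct)
  case (scalar c)
  have "g * scalar c = c *\<^sub>c g" by (simp add: smul_def scalar.iota_central)
  then show ?case by (simp add: scalar_alt act_free_smul_left act_free_smul act_free_one)
next
  case (gen x h)
  have *: "act_free q (g * gen x) a = act_free q g (act_free q (gen x) a)" for g a
    by (simp add: act_free_ract theta_free_mult theta_free_gen ract_gen_mult)
  show ?case
    by (simp add: gen * mult.assoc[symmetric])
next
  case (add x y)
  then show ?case by (simp add: distrib_left act_free_add_left act_free_add)
qed

lemmas act_free_simps = act_free_mult act_free_add_left act_free_diff_left act_free_minus_left act_free_smul_left
  act_free_one act_free_zero_left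

lemma act_free_gen_scalar: "act_free q (gen g) (scalar c) = eps_gen g *\<^sub>c scalar c"
proof -
  have "eps_gen (swap_gen g) = eps_gen g" by (cases g) simp_all
  then show ?thesis by (simp add: act_free_scalar theta_free_gen eps_free_simps) (simp add: scalar_alt mult.commute)
qed

text \<open>\<open>theta_free\<close> exchanges \<open>E\<close> and \<open>F\<close>, so
  \<open>E\<close> acts on a row index through the matrix of \<open>F\<close> and conversely; the
  diagonal generators keep their own matrices.\<close>

lemma act_free_gen_Cons:
  "act_free q (gen g) (u i j * a) = (case g of
      gE n \<Rightarrow> (\<Sum>k\<in>UNIV. (sigma_gen q (gF n) $ i $ k) *\<^sub>c (u k j * act_free q (K n) a)) +
              (\<Sum>k\<in>UNIV. (sigma_gen q (gKi n) $ i $ k) *\<^sub>c (u k j * act_free q (E n) a))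
    | gF n \<Rightarrow> (\<Sum>k\<in>UNIV. (sigma_gen q (gE n) $ i $ k) *\<^sub>c (u k j * act_free q (K n) a)) +
              (\<Sum>k\<in>UNIV. (sigma_gen q (gKi n) $ i $ k) *\<^sub>c (u k j * act_free q (F n) a))
    | _ \<Rightarrow> (\<Sum>k\<in>UNIV. (sigma_gen q g $ i $ k) *\<^sub>c (u k j * act_free q (gen g) a)))"
  by (cases g) (simp_all add: act_free_ract theta_free_gen ract_Cons U_Delta_simps ract_tensor_add
      ract_tensor_single sigma_word_def gen_def[symmetric])

lemma sum_UNIV_idx: "(\<Sum>k\<in>UNIV. f k) = f I1 + (f I2 + f I3)" for f :: "idx \<Rightarrow> 'b::comm_monoid_add"
  by (simp add: UNIV_finite_3)

section \<open>Ideals and presented algebras\<close>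

lemma ring_free_ring: "ring (free_ring :: ('g list \<Rightarrow>\<^sub>0 complex) ring)"
proof (rule ringI)
  show "abelian_group (free_ring :: ('g list \<Rightarrow>\<^sub>0 complex) ring)"
  proof (rule abelian_groupI)
    fix x :: "'g list \<Rightarrow>\<^sub>0 complex"
    have "- x \<oplus>\<^bsub>free_ring\<^esub> x = \<zero>\<^bsub>free_ring\<^esub>" by (simp add: free_ring_def)
    then show "\<exists>y\<in>carrier free_ring. y \<oplus>\<^bsub>free_ring\<^esub> x = \<zero>\<^bsub>free_ring\<^esub>"
      by (intro bexI[of _ "- x"]) (simp_all add: free_ring_def)
  qed (simp_all add: free_ring_def ac_simps)
  show "monoid (free_ring :: ('g list \<Rightarrow>\<^sub>0 complex) ring)"
    by (rule monoidI) (simp_all add: free_ring_def mult.assoc)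
qed (simp_all add: free_ring_def algebra_simps)

lemma ideal_genideal: "ideal (genideal free_ring R) (free_ring :: ('g list \<Rightarrow>\<^sub>0 complex) ring)"
  by (rule ring.genideal_ideal[OF ring_free_ring]) (simp add: free_ring_def)

lemma genideal_base: "r \<in> R \<Longrightarrow> r \<in> genideal free_ring (R :: ('g list \<Rightarrow>\<^sub>0 complex) set)"
  using ring.genideal_self[OF ring_free_ring, of R] by (auto simp: free_ring_def)

lemma genideal_zero: "0 \<in> genideal free_ring (R :: ('g list \<Rightarrow>\<^sub>0 complex) set)"
  using additive_subgroup.zero_closed[OF ideal.axioms(1)[OF ideal_genideal[of R]]]
  by (simp add: free_ring_def)

lemma genideal_add:
  "x \<in> genideal free_ring R \<Longrightarrow> y \<in> genideal free_ring R \<Longrightarrow> x + y \<in> genideal free_ring (R :: ('g list \<Rightarrow>\<^sub>0 complex) set)"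
  using additive_subgroup.a_closed[OF ideal.axioms(1)[OF ideal_genideal[of R]], of x y]
  by (simp add: free_ring_def)

lemma genideal_mult_left: "x \<in> genideal free_ring R \<Longrightarrow> a * x \<in> genideal free_ring (R :: ('g list \<Rightarrow>\<^sub>0 complex) set)"
  using ideal.I_l_closed[OF ideal_genideal[of R], of x a] by (simp add: free_ring_def)

lemma genideal_mult_right: "x \<in> genideal free_ring R \<Longrightarrow> x * a \<in> genideal free_ring (R :: ('g list \<Rightarrow>\<^sub>0 complex) set)"
  using ideal.I_r_closed[OF ideal_genideal[of R], of x a] by (simp add: free_ring_def)

lemma genideal_smul: "x \<in> genideal free_ring R \<Longrightarrow> c *\<^sub>c x \<in> genideal free_ring (R :: ('g list \<Rightarrow>\<^sub>0 complex) set)"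
  by (simp add: smul_def genideal_mult_left)

lemma genideal_minus: "x \<in> genideal free_ring R \<Longrightarrow> - x \<in> genideal free_ring (R :: ('g list \<Rightarrow>\<^sub>0 complex) set)"
  using genideal_mult_left[of x R "- 1"] by simp

lemma genideal_diff:
  "x \<in> genideal free_ring R \<Longrightarrow> y \<in> genideal free_ring R \<Longrightarrow> x - y \<in> genideal free_ring (R :: ('g list \<Rightarrow>\<^sub>0 complex) set)"
  using genideal_add[of x R "- y"] genideal_minus[of y R] by simp

text \<open>The elements satisfying \<open>P\<close> form an ideal, since negation is left
  multiplication by -1, and the generated ideal is the smallest one.\<close>

lemma genideal_induct [consumes 1, case_names base zero add left right]:
  assumes "x \<in> genideal free_ring (R :: ('g list \<Rightarrow>\<^sub>0 complex) set)"
    and base: "\<And>r. r \<in> R \<Longrightarrow> P r" and zero: "P 0" and add: "\<And>x y. P x \<Longrightarrow> P y \<Longrightarrow> P (x + y)"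
    and left: "\<And>a x. P x \<Longrightarrow> P (a * x)" and right: "\<And>a x. P x \<Longrightarrow> P (x * a)"
  shows "P x"
proof -
  have minus: "P (- x)" if "P x" for x using left[OF that, of "- 1"] by simp
  have "ideal {x. P x} free_ring"
  proof (rule idealI[OF ring_free_ring])
    have "inv\<^bsub>add_monoid free_ring\<^esub> x = - x" for x :: "'g list \<Rightarrow>\<^sub>0 complex"
      by (rule monoid.inv_char)
        (use ring.is_monoid[OF ring_free_ring] abelian_group.a_group[OF ring.is_abelian_group[OF ring_free_ring]]
         in \<open>auto simp: free_ring_def group_def\<close>)
    then show "subgroup {x. P x} (add_monoid free_ring)"
      by (intro group.subgroupI abelian_group.a_group[OF ring.is_abelian_group[OF ring_free_ring]])
        (use zero add minus in \<open>auto simp: free_ring_def\<close>)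
  qed (use left right in \<open>auto simp: free_ring_def\<close>)
  then have "genideal free_ring R \<subseteq> {x. P x}"
    using base by (intro ring.genideal_minimal[OF ring_free_ring]) auto
  then show ?thesis using assms(1) by auto
qed

lemma residue_alt: "residue R x = (\<lambda>i. i + x) ` genideal free_ring R"
  by (auto simp: residue_def a_r_coset_def' free_ring_def)

lemma residue_eq_iff: "residue R x = residue R y \<longleftrightarrow> x - y \<in> genideal free_ring R"
proof
  assume "residue R x = residue R y"
  moreover have "x \<in> residue R x" using genideal_zero[of R] by (force simp: residue_alt)
  ultimately obtain i where "i \<in> genideal free_ring R" "x = i + y" by (auto simp: residue_alt)
  then show "x - y \<in> genideal free_ring R" by simp
next
  assume d: "x - y \<in> genideal free_ring R"
  show "residue R x = residue R y"
    unfolding residue_alt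
  proof (intro equalityI subsetI; elim imageE)
    fix z i assume "z = i + x" "i \<in> genideal free_ring R"
    then show "z \<in> (\<lambda>i. i + y) ` genideal free_ring R"
      using genideal_add[OF _ d, of i] by (intro image_eqI[of _ _ "i + (x - y)"]) simp_all
  next
    fix z i assume "z = i + y" "i \<in> genideal free_ring R"
    then show "z \<in> (\<lambda>i. i + x) ` genideal free_ring R"
      using genideal_diff[OF _ d, of i] by (intro image_eqI[of _ _ "i - (x - y)"]) simp_all
  qed
qed

lemma residue_self: "x \<in> residue R x"
  using genideal_zero[of R] by (force simp: residue_alt)

lemma residue_ring_hom: "ring_hom_ring free_ring (presented R) (residue R)"
  using ideal.rcos_ring_hom_ring[OF ideal_genideal[of R]] unfolding presented_def
  by (simp add: residue_def[abs_def])

lemma presented_simps: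
  "residue R x \<oplus>\<^bsub>presented R\<^esub> residue R y = residue R (x + y)"
  "residue R x \<otimes>\<^bsub>presented R\<^esub> residue R y = residue R (x * y)"
  "\<zero>\<^bsub>presented R\<^esub> = residue R 0"
  "\<ominus>\<^bsub>presented R\<^esub> residue R x = residue R (- x)"
  "residue R x \<ominus>\<^bsub>presented R\<^esub> residue R y = residue R (x - y)"
  "carrier (presented R) = range (residue R)"
proof -
  interpret h: ring_hom_ring free_ring "presented R" "residue R" by (rule residue_ring_hom)
  show add: "residue R x \<oplus>\<^bsub>presented R\<^esub> residue R y = residue R (x + y)" for x y
    using h.hom_add[of x y] by (simp add: free_ring_def)
  show "residue R x \<otimes>\<^bsub>presented R\<^esub> residue R y = residue R (x * y)"
    using h.hom_mult[of x y] by (simp add: free_ring_def)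
  show zero: "\<zero>\<^bsub>presented R\<^esub> = residue R 0"
    using h.hom_zero by (simp add: free_ring_def)
  show car: "carrier (presented R) = range (residue R)"
    by (auto simp: presented_def FactRing_def A_RCOSETS_defs residue_def a_r_coset_def' r_coset_def free_ring_def)
  show minus: "\<ominus>\<^bsub>presented R\<^esub> residue R x = residue R (- x)" for x
    by (rule h.S.minus_equality) (auto simp: add zero car)
  show "residue R x \<ominus>\<^bsub>presented R\<^esub> residue R y = residue R (x - y)"
    by (simp add: a_minus_def minus add)
qed

text \<open>A linear left inverse \<open>g\<close> of the inclusion of \<open>S\<close> is a
  projection onto \<open>S\<close>. The complementary projection \<open>x - g x\<close> has kernel
  exactly \<open>S\<close> and changes \<open>x\<close> only by an element of
  \<open>S\<close>.\<close>

lemma ex_linear_projection: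
  assumes sub: "cvs.subspace (S :: ('m::monoid_add \<Rightarrow>\<^sub>0 complex) set)"
  shows "\<exists>\<pi>. (\<forall>x y. \<pi> (x + y) = \<pi> x + \<pi> y) \<and> (\<forall>c x. \<pi> (c *\<^sub>c x) = c *\<^sub>c \<pi> x) \<and>
    (\<forall>x. \<pi> x = 0 \<longleftrightarrow> x \<in> S) \<and> (\<forall>x. x - \<pi> x \<in> S)"
proof -
  interpret vp: vector_space_pair "smul :: complex \<Rightarrow> ('m \<Rightarrow>\<^sub>0 complex) \<Rightarrow> _" "smul :: complex \<Rightarrow> ('m \<Rightarrow>\<^sub>0 complex) \<Rightarrow> _" ..
  obtain g where g: "range g \<subseteq> S" "Vector_Spaces.linear smul smul g" "\<forall>v\<in>S. g v = v"
    using vp.linear_exists_left_inverse_on[OF cvs.linear_ident sub] by (auto simp: inj_on_def)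
  interpret g: Vector_Spaces.linear smul smul g by (rule g)
  have "x - g x = 0 \<longleftrightarrow> x \<in> S" "x - (x - g x) \<in> S" for x using g(1,3) by auto
  then show ?thesis
    by (intro exI[of _ "\<lambda>x. x - g x"]) (simp add: g.add g.scale smul_diff)
qed

abbreviation "A_ideal q \<equiv> genideal free_ring (A_rels q)"
abbreviation "U_ideal q \<equiv> genideal free_ring (U_rels q)"

lemma idx_less [simp]:
  "I1 < I2" "I1 < I3" "I2 < I3" "\<not> I2 < I1" "\<not> I3 < I1" "\<not> I3 < I2"
  by (simp_all add: less_finite_3_def)

lemma subspace_genideal: "cvs.subspace (genideal free_ring R)"
  by (rule cvs.subspaceI) (simp_all add: genideal_zero genideal_add genideal_smul)

lemma star_free_U_ideal: "x \<in> U_ideal q \<Longrightarrow> star_free x \<in> U_ideal q"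
proof (induction rule: genideal_induct)
  case (base r)
  then have "star_free r \<in> U_rels q" by (auto simp: U_rels_def)
  then show ?case by (rule genideal_base)
qed (simp_all add: star_free_zero star_free_add star_free_mult genideal_zero genideal_add
    genideal_mult_left genideal_mult_right)

lemma U_star_residue: "U_star (ucl q x) = ucl q (star_free x)"
proof (intro equalityI subsetI)
  fix y assume "y \<in> U_star (ucl q x)"
  then show "y \<in> ucl q (star_free x)"
    by (auto simp: U_star_def residue_alt star_free_add star_free_U_ideal)
next
  fix y assume "y \<in> ucl q (star_free x)"
  then obtain i where "i \<in> U_ideal q" "y = i + star_free x" by (auto simp: residue_alt)
  then have "y = star_free (star_free i + x)" "star_free i + x \<in> ucl q x"
    by (auto simp: residue_alt star_free_add star_free_U_ideal)
  then show "y \<in> U_star (ucl q x)" by (auto simp: U_star_def)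
qed

section \<open>Permutations of three indices and their lengths\<close>

definition triple :: "'a \<Rightarrow> 'a \<Rightarrow> 'a \<Rightarrow> idx \<Rightarrow> 'a" where
  "triple a b c = case_finite_3 a b c"

lemma triple_simps [simp]: "triple a b c I1 = a" "triple a b c I2 = b" "triple a b c I3 = c"
  by (simp_all add: triple_def)

lemma triple_eq_iff [simp]: "triple a b c = triple a' b' c' \<longleftrightarrow> a = a' \<and> b = b' \<and> c = c'"
  by (metis triple_simps)

lemma triple_eta: "triple (p I1) (p I2) (p I3) = p"
proof
  show "triple (p I1) (p I2) (p I3) i = p i" for i by (cases i) simp_all
qed

lemma all_idx: "(\<forall>i. P i) \<longleftrightarrow> P I1 \<and> P I2 \<and> P I3"
  by (metis finite_3.exhaust)

lemma bij_idx: "{p :: idx \<Rightarrow> idx. bij p} =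
  {triple I1 I2 I3, triple I1 I3 I2, triple I2 I1 I3, triple I2 I3 I1, triple I3 I1 I2, triple I3 I2 I1}"
proof -
  have bij: "bij p \<longleftrightarrow> p I1 \<noteq> p I2 \<and> p I1 \<noteq> p I3 \<and> p I2 \<noteq> p I3" for p :: "idx \<Rightarrow> idx"
  proof -
    have "bij p \<longleftrightarrow> inj p"
      using finite_UNIV_inj_surj[of p] by (auto simp: bij_def)
    also have "\<dots> \<longleftrightarrow> p I1 \<noteq> p I2 \<and> p I1 \<noteq> p I3 \<and> p I2 \<noteq> p I3"
      unfolding inj_def all_idx by auto
    finally show ?thesis .
  qed
  have "bij p \<longleftrightarrow> p \<in> {triple I1 I2 I3, triple I1 I3 I2, triple I2 I1 I3, triple I2 I3 I1, triple I3 I1 I2, triple I3 I2 I1}"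
    for p :: "idx \<Rightarrow> idx"
  proof -
    obtain a b c where p: "p = triple a b c" by (metis triple_eta)
    show ?thesis unfolding bij p by (cases a; cases b; cases c) simp_all
  qed
  then show ?thesis by auto
qed

lemma perm_length_triple:
  "perm_length (triple a b c) = of_bool (b < a) + of_bool (c < a) + of_bool (c < b)"
proof -
  have "{(i, j). i < j \<and> triple a b c j < triple a b c i} =
    (if b < a then {(I1, I2)} else {}) \<union> (if c < a then {(I1, I3)} else {}) \<union> (if c < b then {(I2, I3)} else {})"
  proof (intro Set.set_eqI)
    fix x :: "idx \<times> idx"
    obtain i j where "x = (i, j)" by fastforce
    then show "x \<in> {(i, j). i < j \<and> triple a b c j < triple a b c i} \<longleftrightarrow> x \<in>
      (if b < a then {(I1, I2)} else {}) \<union> (if c < a then {(I1, I3)} else {}) \<union> (if c < b then {(I2, I3)} else {})"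
      by (cases i; cases j) simp_all
  qed
  then show ?thesis by (simp add: perm_length_def)
qed

lemma gen_cases:
  obtains "g = gE N1" | "g = gE N2" | "g = gF N1" | "g = gF N2" | "g = gK N1" | "g = gK N2"
    | "g = gKi N1" | "g = gKi N2" | "g = gH" | "g = gHi"
proof (cases g)
  case (gK n) then show ?thesis using that by (cases n) simp_all
next
  case (gKi n) then show ?thesis using that by (cases n) simp_all
next
  case (gE n) then show ?thesis using that by (cases n) simp_all
next
  case (gF n) then show ?thesis using that by (cases n) simp_all
qed (use that in simp_all)

lemma poly_mapping_sum_singles: "(\<Sum>k\<in>Poly_Mapping.keys x. Poly_Mapping.single k (Poly_Mapping.lookup x k)) = (x :: 'k \<Rightarrow>\<^sub>0 complex)"
  by (rule poly_mapping_eqI) (simp add: lookup_sum lookup_single when_def in_keys_iff)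

lemma eps_free_theta: "eps_free (theta_free h) = eps_free h"
proof (induction h rule: free_algebra_induct)
  case (scalar c)
  show ?case by (simp add: theta_free_single flip: single_Nil)
next
  case (gen g x)
  have "eps_gen (swap_gen g) = eps_gen g" by (cases g) simp_all
  with gen show ?case by (simp add: theta_free_mult theta_free_gen eps_free_simps)
qed (simp add: theta_free_add eps_free_simps)

locale quantum_su3 =
  fixes q :: real
  assumes q_pos: "0 < q" and q_less_1: "q < 1"
begin

text \<open>All scalars are Laurent polynomials in this root.\<close>

definition \<rho> :: complex where "\<rho> = of_real (q powr (1 / 6))"

lemma rho_nz [simp]: "\<rho> \<noteq> 0"
  using q_pos by (simp add: \<rho>_def)

lemma rho_power: "\<rho> ^ n = of_real (q powr (real n / 6))"
  using q_pos by (simp add: \<rho>_def of_real_power[symmetric] powr_realpow[symmetric] powr_powr mult.commute del: of_real_power)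

text \<open>Half powers of \<open>q\<close> come from the \<open>K i\<close> and thirds from
  \<open>H\<close>, hence a sixth root. Negative exponents are listed in two syntactic forms, so
  that the rules match before and after simplification.\<close>

lemma powr_rho:
  "complex_of_real q = \<rho> ^ 6"
  "complex_of_real (q powr (1 / 2)) = \<rho> ^ 3" "complex_of_real (q powr (- 1 / 2)) = 1 / \<rho> ^ 3"
  "complex_of_real (q powr (1 / 3)) = \<rho> ^ 2" "complex_of_real (q powr (- 1 / 3)) = 1 / \<rho> ^ 2"
  "complex_of_real (q powr (2 / 3)) = \<rho> ^ 4" "complex_of_real (q powr (- 2 / 3)) = 1 / \<rho> ^ 4"
  "complex_of_real (q powr (- (1 / 2))) = 1 / \<rho> ^ 3" "complex_of_real (q powr (- (1 / 3))) = 1 / \<rho> ^ 2"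
  "complex_of_real (q powr (- (2 / 3))) = 1 / \<rho> ^ 4"
  using q_pos by (simp_all add: rho_power powr_minus_divide)

lemma rho_power_12: "\<rho> ^ 12 \<noteq> 1"
proof
  assume "\<rho> ^ 12 = 1"
  then have "complex_of_real (q ^ 2) = of_real 1"
    by (simp add: powr_rho)
  then have "q ^ 2 = 1" by (simp only: of_real_eq_iff)
  then show False using q_pos q_less_1 by (simp add: power2_eq_1_iff)
qed

abbreviation "e1 \<equiv> act_free q (E N1)"
abbreviation "e2 \<equiv> act_free q (E N2)"
abbreviation "f1 \<equiv> act_free q (F N1)"
abbreviation "f2 \<equiv> act_free q (F N2)"
abbreviation "k1 \<equiv> act_free q (K N1)"
abbreviation "k2 \<equiv> act_free q (K N2)"
abbreviation "k1i \<equiv> act_free q (Ki N1)"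
abbreviation "k2i \<equiv> act_free q (Ki N2)"
abbreviation "h1 \<equiv> act_free q H"
abbreviation "h1i \<equiv> act_free q Hi"

section \<open>The relations of the quantum enveloping algebra act as zero\<close>

text \<open>The action touches only the row index and leaves the column \<open>j\<close> alone, so
  the module-algebra rule becomes a finite table by rows.\<close>

lemma ops_Cons:
  "e1 (u I1 j * a) = u I2 j * k1 a + \<rho>^3 *\<^sub>c (u I1 j * e1 a)"
  "e1 (u I2 j * a) = (1 / \<rho>^3) *\<^sub>c (u I2 j * e1 a)"
  "e1 (u I3 j * a) = u I3 j * e1 a"
  "e2 (u I1 j * a) = u I1 j * e2 a"
  "e2 (u I2 j * a) = u I3 j * k2 a + \<rho>^3 *\<^sub>c (u I2 j * e2 a)"
  "e2 (u I3 j * a) = (1 / \<rho>^3) *\<^sub>c (u I3 j * e2 a)"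
  "f1 (u I1 j * a) = \<rho>^3 *\<^sub>c (u I1 j * f1 a)"
  "f1 (u I2 j * a) = u I1 j * k1 a + (1 / \<rho>^3) *\<^sub>c (u I2 j * f1 a)"
  "f1 (u I3 j * a) = u I3 j * f1 a"
  "f2 (u I1 j * a) = u I1 j * f2 a"
  "f2 (u I2 j * a) = \<rho>^3 *\<^sub>c (u I2 j * f2 a)"
  "f2 (u I3 j * a) = u I2 j * k2 a + (1 / \<rho>^3) *\<^sub>c (u I3 j * f2 a)"
  "k1 (u I1 j * a) = (1 / \<rho>^3) *\<^sub>c (u I1 j * k1 a)"
  "k1 (u I2 j * a) = \<rho>^3 *\<^sub>c (u I2 j * k1 a)"
  "k1 (u I3 j * a) = u I3 j * k1 a"
  "k1i (u I1 j * a) = \<rho>^3 *\<^sub>c (u I1 j * k1i a)"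
  "k1i (u I2 j * a) = (1 / \<rho>^3) *\<^sub>c (u I2 j * k1i a)"
  "k1i (u I3 j * a) = u I3 j * k1i a"
  "k2 (u I1 j * a) = u I1 j * k2 a"
  "k2 (u I2 j * a) = (1 / \<rho>^3) *\<^sub>c (u I2 j * k2 a)"
  "k2 (u I3 j * a) = \<rho>^3 *\<^sub>c (u I3 j * k2 a)"
  "k2i (u I1 j * a) = u I1 j * k2i a"
  "k2i (u I2 j * a) = \<rho>^3 *\<^sub>c (u I2 j * k2i a)"
  "k2i (u I3 j * a) = (1 / \<rho>^3) *\<^sub>c (u I3 j * k2i a)"
  "h1 (u I1 j * a) = (1 / \<rho>^2) *\<^sub>c (u I1 j * h1 a)"
  "h1 (u I2 j * a) = \<rho>^4 *\<^sub>c (u I2 j * h1 a)"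
  "h1 (u I3 j * a) = (1 / \<rho>^2) *\<^sub>c (u I3 j * h1 a)"
  "h1i (u I1 j * a) = \<rho>^2 *\<^sub>c (u I1 j * h1i a)"
  "h1i (u I2 j * a) = (1 / \<rho>^4) *\<^sub>c (u I2 j * h1i a)"
  "h1i (u I3 j * a) = \<rho>^2 *\<^sub>c (u I3 j * h1i a)"
  by (simp_all add: act_free_gen_Cons sum_UNIV_idx diag3_def munit_def powr_rho)

lemma ops_scalar:
  "e1 (scalar c) = 0" "e2 (scalar c) = 0" "f1 (scalar c) = 0" "f2 (scalar c) = 0"
  "k1 (scalar c) = scalar c" "k2 (scalar c) = scalar c" "k1i (scalar c) = scalar c" "k2i (scalar c) = scalar c"
  "h1 (scalar c) = scalar c" "h1i (scalar c) = scalar c"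
  by (simp_all add: act_free_gen_scalar)

lemma afree_induct [case_names scalar row1 row2 row3 add]:
  assumes "\<And>c. P (scalar c)"
    and "\<And>j x. P x \<Longrightarrow> P (u I1 j * x)" "\<And>j x. P x \<Longrightarrow> P (u I2 j * x)" "\<And>j x. P x \<Longrightarrow> P (u I3 j * x)"
    and "\<And>x y. P x \<Longrightarrow> P y \<Longrightarrow> P (x + y)"
  shows "P (x :: afree)"
proof (induction x rule: free_algebra_induct)
  case (gen g x)
  obtain i j where "g = (i, j)" by fastforce
  then show ?case using gen by (cases i) (simp_all add: assms)
qed (simp_all add: assms)

lemmas lookup_simps = lookup_smul lookup_add lookup_minus

lemmas lin_simps = act_free_add act_free_smul act_free_diff act_free_minus act_free_zero smul_mult_left smul_mult_right
  distrib_left right_diff_distrib smul_add smul_diff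

lemma diag_inv:
  "k1 (k1i a) = a" "k1i (k1 a) = a" "k2 (k2i a) = a" "k2i (k2 a) = a" "h1 (h1i a) = a" "h1i (h1 a) = a"
  by (induction a rule: afree_induct; simp add: ops_scalar ops_Cons lin_simps)+

lemma diag_comm:
  "k2 (k1 a) = k1 (k2 a)" "k1i (k2 a) = k2 (k1i a)" "k2i (k1 a) = k1 (k2i a)" "k2i (k1i a) = k1i (k2i a)"
  "h1 (k1 a) = k1 (h1 a)" "h1 (k2 a) = k2 (h1 a)" "h1 (k1i a) = k1i (h1 a)" "h1 (k2i a) = k2i (h1 a)"
  "h1i (k1 a) = k1 (h1i a)" "h1i (k2 a) = k2 (h1i a)" "h1i (k1i a) = k1i (h1i a)" "h1i (k2i a) = k2i (h1i a)"
  by (induction a rule: afree_induct; simp add: ops_scalar ops_Cons lin_simps mult.commute)+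

lemma h_cube: "h1 (h1 (h1 a)) = k1 (k1 (k2i (k2i a)))"
  by (induction a rule: afree_induct; simp add: ops_scalar ops_Cons lin_simps; simp add: field_simps)

text \<open>Oriented so that the diagonal operators move outwards past \<open>e1\<close>. With the
  three companion lemmas this fixes a common normal form for checking the remaining
  relations.\<close>

lemma weights_e1:
  "e1 (k1 a) = (1 / \<rho>^6) *\<^sub>c k1 (e1 a)" "e1 (k1i a) = \<rho>^6 *\<^sub>c k1i (e1 a)"
  "e1 (k2 a) = \<rho>^3 *\<^sub>c k2 (e1 a)" "e1 (k2i a) = (1 / \<rho>^3) *\<^sub>c k2i (e1 a)"
  "e1 (h1 a) = (1 / \<rho>^6) *\<^sub>c h1 (e1 a)" "e1 (h1i a) = \<rho>^6 *\<^sub>c h1i (e1 a)"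
  \<comment> \<open>After the induction hypothesis both sides combine the same elements, and
    comparing coefficients leaves identities of rational functions in \<open>\<rho>\<close>. The
    later relations are checked in the same way.\<close>
  by (induction a rule: afree_induct; simp add: ops_scalar ops_Cons lin_simps diag_comm diag_inv;
      (rule poly_mapping_eqI)?; simp add: lookup_simps field_simps)+

lemma weights_e2:
  "e2 (k2 a) = (1 / \<rho>^6) *\<^sub>c k2 (e2 a)" "e2 (k2i a) = \<rho>^6 *\<^sub>c k2i (e2 a)"
  "e2 (k1 a) = \<rho>^3 *\<^sub>c k1 (e2 a)" "e2 (k1i a) = (1 / \<rho>^3) *\<^sub>c k1i (e2 a)"
  "e2 (h1 a) = \<rho>^6 *\<^sub>c h1 (e2 a)" "e2 (h1i a) = (1 / \<rho>^6) *\<^sub>c h1i (e2 a)"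
  by (induction a rule: afree_induct; simp add: ops_scalar ops_Cons lin_simps diag_comm diag_inv;
      (rule poly_mapping_eqI)?; simp add: lookup_simps field_simps)+

lemma weights_f1:
  "f1 (k1 a) = \<rho>^6 *\<^sub>c k1 (f1 a)" "f1 (k1i a) = (1 / \<rho>^6) *\<^sub>c k1i (f1 a)"
  "f1 (k2 a) = (1 / \<rho>^3) *\<^sub>c k2 (f1 a)" "f1 (k2i a) = \<rho>^3 *\<^sub>c k2i (f1 a)"
  "f1 (h1 a) = \<rho>^6 *\<^sub>c h1 (f1 a)" "f1 (h1i a) = (1 / \<rho>^6) *\<^sub>c h1i (f1 a)"
  by (induction a rule: afree_induct; simp add: ops_scalar ops_Cons lin_simps diag_comm diag_inv;
      (rule poly_mapping_eqI)?; simp add: lookup_simps field_simps)+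

lemma weights_f2:
  "f2 (k2 a) = \<rho>^6 *\<^sub>c k2 (f2 a)" "f2 (k2i a) = (1 / \<rho>^6) *\<^sub>c k2i (f2 a)"
  "f2 (k1 a) = (1 / \<rho>^3) *\<^sub>c k1 (f2 a)" "f2 (k1i a) = \<rho>^3 *\<^sub>c k1i (f2 a)"
  "f2 (h1 a) = (1 / \<rho>^6) *\<^sub>c h1 (f2 a)" "f2 (h1i a) = \<rho>^6 *\<^sub>c h1i (f2 a)"
  by (induction a rule: afree_induct; simp add: ops_scalar ops_Cons lin_simps diag_comm diag_inv;
      (rule poly_mapping_eqI)?; simp add: lookup_simps field_simps)+

lemmas weights = weights_e1 weights_e2 weights_f1 weights_f2

text \<open>This is \<open>1 / (q - 1 / q)\<close>, the factor in the commutator of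
  \<open>E i\<close> and \<open>F i\<close>.\<close>

definition \<delta> :: complex where "\<delta> = \<rho>^6 / (\<rho>^12 - 1)"

lemma ef_comm:
  "e1 (f2 a) = f2 (e1 a)" "e2 (f1 a) = f1 (e2 a)"
  by (induction a rule: afree_induct; simp add: ops_scalar ops_Cons lin_simps weights diag_comm diag_inv;
      (rule poly_mapping_eqI)?; simp add: lookup_simps field_simps)+

lemma delta: "\<rho>^12 * \<delta> = \<rho>^6 + \<delta>"
  using rho_power_12 by (simp add: \<delta>_def field_simps)

text \<open>Clearing denominators in the commutator checks produces this product; the tail
  \<open>x\<close> lets the rule act inside longer products.\<close>

lemma delta_15: "\<delta> * (\<rho>^15 * x) = \<rho>^9 * x + \<delta> * (\<rho>^3 * x)"
proof -
  have "\<rho>^15 = \<rho>^3 * \<rho>^12" "\<rho>^9 = \<rho>^3 * \<rho>^6" by (simp_all flip: power_add)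
  then have "\<delta> * (\<rho>^15 * x) = \<rho>^3 * x * (\<rho>^12 * \<delta>)" by (simp only: mult_ac)
  then show ?thesis unfolding delta \<open>\<rho>^9 = \<rho>^3 * \<rho>^6\<close> by (simp only: distrib_left mult_ac)
qed

lemma ef_diag_1: "e1 (f1 a) = f1 (e1 a) + \<delta> *\<^sub>c (k1 (k1 a) - k1i (k1i a))"
  by (induction a rule: afree_induct;
     simp add: ops_scalar ops_Cons lin_simps weights diag_comm diag_inv;
     (rule poly_mapping_eqI)?;
     simp add: lookup_simps field_simps delta_15)

lemma ef_diag_2: "e2 (f2 a) = f2 (e2 a) + \<delta> *\<^sub>c (k2 (k2 a) - k2i (k2i a))"
  by (induction a rule: afree_induct;
     simp add: ops_scalar ops_Cons lin_simps weights diag_comm diag_inv;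
     (rule poly_mapping_eqI)?;
     simp add: lookup_simps field_simps delta_15)

text \<open>Solved for the only monomial in which \<open>e1\<close> does not act directly on the
  vector. On forms the right-hand side is then known, because \<open>E N1\<close> is prescribed on
  their components.\<close>

lemma serre_e1: "e1 (e1 (e2 a)) = (\<rho>^6 + 1 / \<rho>^6) *\<^sub>c e1 (e2 (e1 a)) - e2 (e1 (e1 a))"
  by (induction a rule: afree_induct; simp add: ops_scalar ops_Cons lin_simps weights diag_comm diag_inv;
      (rule poly_mapping_eqI)?; simp add: lookup_simps field_simps)

lemma serre_e2: "e2 (e2 (e1 a)) = (\<rho>^6 + 1 / \<rho>^6) *\<^sub>c e2 (e1 (e2 a)) - e1 (e2 (e2 a))"
  by (induction a rule: afree_induct; simp add: ops_scalar ops_Cons lin_simps weights diag_comm diag_inv;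
      (rule poly_mapping_eqI)?; simp add: lookup_simps field_simps)

lemma serre_f1: "f1 (f1 (f2 a)) = (\<rho>^6 + 1 / \<rho>^6) *\<^sub>c f1 (f2 (f1 a)) - f2 (f1 (f1 a))"
  by (induction a rule: afree_induct; simp add: ops_scalar ops_Cons lin_simps weights diag_comm diag_inv;
      (rule poly_mapping_eqI)?; simp add: lookup_simps field_simps)

lemma serre_f2: "f2 (f2 (f1 a)) = (\<rho>^6 + 1 / \<rho>^6) *\<^sub>c f2 (f1 (f2 a)) - f1 (f2 (f2 a))"
  by (induction a rule: afree_induct; simp add: ops_scalar ops_Cons lin_simps weights diag_comm diag_inv;
      (rule poly_mapping_eqI)?; simp add: lookup_simps field_simps)

lemmas serre = serre_e1 serre_e2 serre_f1 serre_f2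

lemma act_free_U_rels0:
  assumes "r \<in> U_rels0 q"
  shows "act_free q r a = 0 \<and> act_free q (star_free r) a = 0"
proof -
  have node: "(UNIV :: node set) = {N1, N2}"
    using node.exhaust by blast
  have pairs: "{(i :: node, j). i \<noteq> j} = {(N1, N2), (N2, N1)}"
  proof (rule Set.set_eqI)
    fix x :: "node \<times> node"
    show "x \<in> {(i, j). i \<noteq> j} \<longleftrightarrow> x \<in> {(N1, N2), (N2, N1)}"
      by (cases x; cases "fst x"; cases "snd x"; simp)
  qed
  have d: "complex_of_real (1 / (q - 1 / q)) = \<delta>"
    using q_pos rho_power_12 by (simp add: powr_rho \<delta>_def field_simps)
  have s: "complex_of_real (q + 1 / q) = \<rho>^6 + 1 / \<rho>^6" "complex_of_real (1 / q) = 1 / \<rho>^6"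
    by (simp_all add: powr_rho)
  \<comment> \<open>All coefficients are real, so a relation and its adjoint carry the same
    scalars.\<close>
  have cnj: "cnj \<rho> = \<rho>" "cnj \<delta> = \<delta>" by (simp_all add: \<delta>_def \<rho>_def)
  show ?thesis
    using assms unfolding U_rels0_def node pairs UN_insert UN_empty prod.case d s powr_rho
    apply (elim UnE insertE emptyE)
    by (simp_all only: scalar_mult star_free_add star_free_mult star_free_smul star_free_diff star_free_gen star_free_one swap_gen.simps
     cnj complex_cnj_one complex_cnj_divide complex_cnj_power complex_cnj_add smul_mult_left smul_mult_right act_free_simps
     power2_eq_square[where 'a = ufree] power3_eq_cube[where 'a = ufree])
     (simp_all only: lin_simps diag_inv weights,
     simp_all add: diag_comm diag_inv ef_comm ef_diag_1 ef_diag_2 serre h_cube lin_simps)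
qed

lemma act_free_U_ideal:
  assumes "h \<in> U_ideal q"
  shows "act_free q h a = 0"
proof -
  \<comment> \<open>Quantified over \<open>a\<close>: in a product with an ideal element on the
    left, that element acts on the image of \<open>a\<close> under the right factor.\<close>
  have "\<forall>a. act_free q h a = 0"
    using assms
  proof (induction rule: genideal_induct)
    case (base r)
    then show ?case using act_free_U_rels0 unfolding U_rels_def by auto
  qed (simp_all add: act_free_simps act_free_zero)
  then show ?thesis by simp
qed

lemma ops_u:
  "e1 (u I1 j) = u I2 j" "e1 (u I2 j) = 0" "e1 (u I3 j) = 0"
  "e2 (u I1 j) = 0" "e2 (u I2 j) = u I3 j" "e2 (u I3 j) = 0"
  "f1 (u I1 j) = 0" "f1 (u I2 j) = u I1 j" "f1 (u I3 j) = 0"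
  "f2 (u I1 j) = 0" "f2 (u I2 j) = 0" "f2 (u I3 j) = u I2 j"
  "k1 (u I1 j) = (1 / \<rho>^3) *\<^sub>c u I1 j" "k1 (u I2 j) = \<rho>^3 *\<^sub>c u I2 j" "k1 (u I3 j) = u I3 j"
  "k1i (u I1 j) = \<rho>^3 *\<^sub>c u I1 j" "k1i (u I2 j) = (1 / \<rho>^3) *\<^sub>c u I2 j" "k1i (u I3 j) = u I3 j"
  "k2 (u I1 j) = u I1 j" "k2 (u I2 j) = (1 / \<rho>^3) *\<^sub>c u I2 j" "k2 (u I3 j) = \<rho>^3 *\<^sub>c u I3 j"
  "k2i (u I1 j) = u I1 j" "k2i (u I2 j) = \<rho>^3 *\<^sub>c u I2 j" "k2i (u I3 j) = (1 / \<rho>^3) *\<^sub>c u I3 j"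
  "h1 (u I1 j) = (1 / \<rho>^2) *\<^sub>c u I1 j" "h1 (u I2 j) = \<rho>^4 *\<^sub>c u I2 j" "h1 (u I3 j) = (1 / \<rho>^2) *\<^sub>c u I3 j"
  "h1i (u I1 j) = \<rho>^2 *\<^sub>c u I1 j" "h1i (u I2 j) = (1 / \<rho>^4) *\<^sub>c u I2 j" "h1i (u I3 j) = \<rho>^2 *\<^sub>c u I3 j"
  using ops_Cons[of j 1] ops_scalar[of 1] by (simp_all add: scalar_alt)

lemma ops_one:
  "e1 1 = 0" "e2 1 = 0" "f1 1 = 0" "f2 1 = 0" "k1 1 = 1" "k2 1 = 1" "k1i 1 = 1" "k2i 1 = 1" "h1 1 = 1" "h1i 1 = 1"
  using ops_scalar[of 1] by (simp_all add: scalar_alt)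

section \<open>Stability of the relations of quantum SU(3)\<close>

lemma leibniz_diag:
  "k1 (a * b) = k1 a * k1 b" "k2 (a * b) = k2 a * k2 b" "k1i (a * b) = k1i a * k1i b" "k2i (a * b) = k2i a * k2i b"
  "h1 (a * b) = h1 a * h1 b" "h1i (a * b) = h1i a * h1i b"
  by (induction a rule: afree_induct)
    (simp_all only: scalar_mult ops_scalar ops_Cons mult.assoc act_free_smul act_free_add distrib_right smul_mult_left)

text \<open>Twisted derivations: the two terms of the coproduct put \<open>K\<close> on the right
  factor and its inverse on the left one. Arbitrary left factors are allowed because ideal elements
  get multiplied from both sides.\<close>

lemma leibniz_ef:
  "e1 (a * b) = e1 a * k1 b + k1i a * e1 b" "e2 (a * b) = e2 a * k2 b + k2i a * e2 b"
  "f1 (a * b) = f1 a * k1 b + k1i a * f1 b" "f2 (a * b) = f2 a * k2 b + k2i a * f2 b"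
  by (induction a rule: afree_induct)
    (simp_all only: scalar_mult ops_scalar ops_Cons mult.assoc act_free_smul act_free_add distrib_right distrib_left
      smul_mult_left smul_mult_right smul_add smul_smul leibniz_diag ops_u add_ac mult_zero_left add_0_left)

lemmas leibniz = leibniz_diag leibniz_ef

lemma A_rels_alt: "A_rels q =
   (\<Union>(i, j)\<in>{(i, j). i < j}. \<Union>k. {u i k * u j k - \<rho>^6 *\<^sub>c (u j k * u i k), u k i * u k j - \<rho>^6 *\<^sub>c (u k j * u k i)}) \<union>
   (\<Union>(i, j)\<in>{(i, j). i < j}. \<Union>(k, l)\<in>{(k, l). k < l}.
     {u i l * u j k - u j k * u i l, (u i k * u j l - u j l * u i k) - (\<rho>^6 - 1 / \<rho>^6) *\<^sub>c (u i l * u j k)}) \<union>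
   {u I1 I1 * u I2 I2 * u I3 I3 - \<rho>^6 *\<^sub>c (u I1 I1 * u I2 I3 * u I3 I2) - \<rho>^6 *\<^sub>c (u I1 I2 * u I2 I1 * u I3 I3)
    + \<rho>^12 *\<^sub>c (u I1 I2 * u I2 I3 * u I3 I1) + \<rho>^12 *\<^sub>c (u I1 I3 * u I2 I1 * u I3 I2)
    - \<rho>^18 *\<^sub>c (u I1 I3 * u I2 I2 * u I3 I1) - 1}"
proof -
  have pw: "(- (\<rho>^6)) ^ 2 = \<rho>^12" "(- (\<rho>^6)) ^ 3 = - (\<rho>^18)"
    by (simp_all flip: power_mult)
  have det: "(\<Sum>p\<in>{p. bij p}. scalar (complex_of_real ((- q) ^ perm_length p)) * u I1 (p I1) * u I2 (p I2) * u I3 (p I3)) =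
    u I1 I1 * u I2 I2 * u I3 I3 - \<rho>^6 *\<^sub>c (u I1 I1 * u I2 I3 * u I3 I2) - \<rho>^6 *\<^sub>c (u I1 I2 * u I2 I1 * u I3 I3)
    + \<rho>^12 *\<^sub>c (u I1 I2 * u I2 I3 * u I3 I1) + \<rho>^12 *\<^sub>c (u I1 I3 * u I2 I1 * u I3 I2)
    - \<rho>^18 *\<^sub>c (u I1 I3 * u I2 I2 * u I3 I1)"
    unfolding bij_idx
    by (simp add: perm_length_triple scalar_mult powr_rho smul_mult_left smul_minus_left pw)
  have q: "complex_of_real (q - 1 / q) = \<rho>^6 - 1 / \<rho>^6" by (simp add: powr_rho)
  show ?thesis
    unfolding A_rels_def det unfolding q powr_rho scalar_mult smul_mult_left ..
qed

text \<open>A linear choice of representatives: equations in the quotient become equations in the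
  free algebra.\<close>

definition nf :: "afree \<Rightarrow> afree" where
  "nf = (SOME \<pi>. (\<forall>x y. \<pi> (x + y) = \<pi> x + \<pi> y) \<and> (\<forall>c x. \<pi> (c *\<^sub>c x) = c *\<^sub>c \<pi> x) \<and>
    (\<forall>x. \<pi> x = 0 \<longleftrightarrow> x \<in> A_ideal q) \<and> (\<forall>x. x - \<pi> x \<in> A_ideal q))"

lemma nf_add: "nf (x + y) = nf x + nf y"
  and nf_smul: "nf (c *\<^sub>c x) = c *\<^sub>c nf x"
  and nf_eq_zero_iff: "nf x = 0 \<longleftrightarrow> x \<in> A_ideal q"
  and nf_diff_mem: "x - nf x \<in> A_ideal q"
  using someI_ex[OF ex_linear_projection[OF subspace_genideal[of "A_rels q"]]] by (simp_all add: nf_def)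

lemma nf_zero: "nf 0 = 0"
  using nf_smul[of 0 0] by simp

lemma nf_minus: "nf (- x) = - nf x"
  using nf_smul[of "-1" x] by (simp add: smul_minus_left)

lemma nf_diff: "nf (x - y) = nf x - nf y"
  using nf_add[of x "- y"] by (simp add: nf_minus)

lemmas nf_linear = nf_add nf_smul nf_zero nf_minus nf_diff

section \<open>Straightening modulo the relations of quantum SU(3)\<close>

lemma A_ideal_base:
  "i < j \<Longrightarrow> u i k * u j k - \<rho>^6 *\<^sub>c (u j k * u i k) \<in> A_ideal q"
  "i < j \<Longrightarrow> u k i * u k j - \<rho>^6 *\<^sub>c (u k j * u k i) \<in> A_ideal q"
  "i < j \<Longrightarrow> k < l \<Longrightarrow> u i l * u j k - u j k * u i l \<in> A_ideal q"
  "i < j \<Longrightarrow> k < l \<Longrightarrow> (u i k * u j l - u j l * u i k) - (\<rho>^6 - 1 / \<rho>^6) *\<^sub>c (u i l * u j k) \<in> A_ideal q"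
proof -
  assume ij: "i < j"
  then have "u i k * u j k - \<rho>^6 *\<^sub>c (u j k * u i k) \<in> A_rels q"
    unfolding A_rels_alt by (intro UnI1 UN_I[of "(i, j)"]) (simp, simp only: prod.case, intro UN_I[of k], simp_all)
  then show "u i k * u j k - \<rho>^6 *\<^sub>c (u j k * u i k) \<in> A_ideal q" by (rule genideal_base)
  have "u k i * u k j - \<rho>^6 *\<^sub>c (u k j * u k i) \<in> A_rels q"
    unfolding A_rels_alt using ij by (intro UnI1 UN_I[of "(i, j)"]) (simp, simp only: prod.case, intro UN_I[of k], simp_all)
  then show "u k i * u k j - \<rho>^6 *\<^sub>c (u k j * u k i) \<in> A_ideal q" by (rule genideal_base)
  assume kl: "k < l"
  have "u i l * u j k - u j k * u i l \<in> A_rels q"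
    unfolding A_rels_alt using ij kl
    by (rule_tac UnI1, rule_tac UnI2, intro UN_I[of "(i, j)"]) (simp, simp only: prod.case, intro UN_I[of "(k, l)"], simp_all)
  then show "u i l * u j k - u j k * u i l \<in> A_ideal q" by (rule genideal_base)
  have "(u i k * u j l - u j l * u i k) - (\<rho>^6 - 1 / \<rho>^6) *\<^sub>c (u i l * u j k) \<in> A_rels q"
    unfolding A_rels_alt using ij kl
    by (rule_tac UnI1, rule_tac UnI2, intro UN_I[of "(i, j)"]) (simp, simp only: prod.case, intro UN_I[of "(k, l)"], simp_all)
  then show "(u i k * u j l - u j l * u i k) - (\<rho>^6 - 1 / \<rho>^6) *\<^sub>c (u i l * u j k) \<in> A_ideal q" by (rule genideal_base)
qed

lemma A_rels_cases:
  assumes "r \<in> A_rels q"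
  obtains (R1) i j k where "i < j" "r = u i k * u j k - \<rho>^6 *\<^sub>c (u j k * u i k)"
    | (R2) i j k where "i < j" "r = u k i * u k j - \<rho>^6 *\<^sub>c (u k j * u k i)"
    | (R3) i j k l where "i < j" "k < l" "r = u i l * u j k - u j k * u i l"
    | (R4) i j k l where "i < j" "k < l" "r = (u i k * u j l - u j l * u i k) - (\<rho>^6 - 1 / \<rho>^6) *\<^sub>c (u i l * u j k)"
    | (det) "r = u I1 I1 * u I2 I2 * u I3 I3 - \<rho>^6 *\<^sub>c (u I1 I1 * u I2 I3 * u I3 I2) - \<rho>^6 *\<^sub>c (u I1 I2 * u I2 I1 * u I3 I3)
    + \<rho>^12 *\<^sub>c (u I1 I2 * u I2 I3 * u I3 I1) + \<rho>^12 *\<^sub>c (u I1 I3 * u I2 I1 * u I3 I2)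
    - \<rho>^18 *\<^sub>c (u I1 I3 * u I2 I2 * u I3 I1) - 1"
  using assms unfolding A_rels_alt
proof (elim UnE)
  assume "r \<in> (\<Union>(i, j)\<in>{(i, j). i < j}. \<Union>k. {u i k * u j k - \<rho>^6 *\<^sub>c (u j k * u i k), u k i * u k j - \<rho>^6 *\<^sub>c (u k j * u k i)})"
  then obtain i j k where "i < j"
    "r = u i k * u j k - \<rho>^6 *\<^sub>c (u j k * u i k) \<or> r = u k i * u k j - \<rho>^6 *\<^sub>c (u k j * u k i)" by auto
  then show thesis using that(1,2) by metis
next
  assume "r \<in> (\<Union>(i, j)\<in>{(i, j). i < j}. \<Union>(k, l)\<in>{(k, l). k < l}.
     {u i l * u j k - u j k * u i l, (u i k * u j l - u j l * u i k) - (\<rho>^6 - 1 / \<rho>^6) *\<^sub>c (u i l * u j k)})"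
  then obtain i j k l where "i < j" "k < l"
    "r = u i l * u j k - u j k * u i l \<or> r = (u i k * u j l - u j l * u i k) - (\<rho>^6 - 1 / \<rho>^6) *\<^sub>c (u i l * u j k)"
    by auto
  then show thesis using that(3,4) by metis
qed (use that(5) in simp)

lemma smul_eq_imp:
  assumes "x = c *\<^sub>c y" "c \<noteq> 0"
  shows "y = (1 / c) *\<^sub>c (x :: 'm::monoid_add \<Rightarrow>\<^sub>0 complex)"
  using assms by simp

text \<open>The relations are read as rewrite rules towards increasing rows and, within a row,
  increasing columns. All that is used of \<open>nf\<close> is that it is linear and kills the
  ideal.\<close>

lemma nf_R1: "i < j \<Longrightarrow> nf (u j k * u i k) = (1 / \<rho>^6) *\<^sub>c nf (u i k * u j k)"
  using A_ideal_base(1)[of i j k, folded nf_eq_zero_iff] by (intro smul_eq_imp) (simp_all add: nf_linear)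

lemma nf_R2: "i < j \<Longrightarrow> nf (u k j * u k i) = (1 / \<rho>^6) *\<^sub>c nf (u k i * u k j)"
  using A_ideal_base(2)[of i j k, folded nf_eq_zero_iff] by (intro smul_eq_imp) (simp_all add: nf_linear)

lemma nf_R3: "i < j \<Longrightarrow> k < l \<Longrightarrow> nf (u j k * u i l) = nf (u i l * u j k)"
  using A_ideal_base(3)[of i j k l, folded nf_eq_zero_iff] by (simp add: nf_linear)

lemma nf_R4: "i < j \<Longrightarrow> k < l \<Longrightarrow>
    nf (u j l * u i k) = nf (u i k * u j l) - (\<rho>^6 - 1 / \<rho>^6) *\<^sub>c nf (u i l * u j k)"
  using A_ideal_base(4)[of i j k l, folded nf_eq_zero_iff] by (simp add: nf_linear algebra_simps)

text \<open>Exchanges within a row, in the first two or the last two letters of a cubic monomial,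
  suffice for the determinant: replacing one of the rows \<open>I1\<close>, \<open>I2\<close>,
  \<open>I3\<close> by a neighbour makes two adjacent letters share a row.\<close>

lemma nf_R2_left: "i < j \<Longrightarrow> nf (u k j * (u k i * x)) = (1 / \<rho>^6) *\<^sub>c nf (u k i * (u k j * x))"
  using genideal_mult_right[OF A_ideal_base(2)[of i j k], of x, folded nf_eq_zero_iff]
  by (intro smul_eq_imp) (simp_all add: nf_linear left_diff_distrib smul_mult_left mult.assoc)

lemma nf_R2_right: "i < j \<Longrightarrow> nf (u a b * (u k j * u k i)) = (1 / \<rho>^6) *\<^sub>c nf (u a b * (u k i * u k j))"
  using genideal_mult_left[OF A_ideal_base(2)[of i j k], of "u a b", folded nf_eq_zero_iff]
  by (intro smul_eq_imp) (simp_all add: nf_linear right_diff_distrib smul_mult_right)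

lemmas nf_expand = leibniz ops_u ops_one lin_simps left_diff_distrib distrib_right smul_mult_left smul_mult_right smul_smul
    mult_zero_left mult_zero_right smul_zero add_0_left add_0_right diff_zero diff_0 nf_linear

lemmas nf_order = nf_R1 nf_R2 nf_R3 nf_R4 nf_R2_left nf_R2_right idx_less mult.assoc smul_smul

lemma idx_less_cases:
  assumes "i < j"
  obtains "i = I1" "j = I2" | "i = I1" "j = I3" | "i = I2" "j = I3"
  using assms by (cases i; cases j; simp)

text \<open>The twisted Leibniz rule followed by straightening and comparison of coefficients. Here
  and in the next three checks the columns stay symbolic; only generator and rows are split into
  cases.\<close>

lemma nf_act_R1: "i < j \<Longrightarrow> nf (act_free q (gen g) (u i k * u j k - \<rho>^6 *\<^sub>c (u j k * u i k))) = 0"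
  apply (cases g rule: gen_cases; erule idx_less_cases)
  apply (simp_all only: nf_expand)
  apply (simp_all only: nf_order smul_minus_left)
  by (rule poly_mapping_eqI; simp add: lookup_simps field_simps)+

lemma nf_act_R2: "k < l \<Longrightarrow> nf (act_free q (gen g) (u i k * u i l - \<rho>^6 *\<^sub>c (u i l * u i k))) = 0"
  apply (cases g rule: gen_cases; cases i)
  apply (simp_all only: nf_expand)
  apply (simp_all only: nf_order smul_minus_left)
  by (rule poly_mapping_eqI; simp add: lookup_simps field_simps)+

lemma nf_act_R3: "i < j \<Longrightarrow> k < l \<Longrightarrow> nf (act_free q (gen g) (u i l * u j k - u j k * u i l)) = 0"
  apply (cases g rule: gen_cases; erule idx_less_cases)
  apply (simp_all only: nf_expand)
  apply (simp_all only: nf_order smul_minus_left)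
  by (rule poly_mapping_eqI; simp add: lookup_simps field_simps)+

lemma nf_act_R4: "i < j \<Longrightarrow> k < l \<Longrightarrow> nf (act_free q (gen g) ((u i k * u j l - u j l * u i k) - (\<rho>^6 - 1 / \<rho>^6) *\<^sub>c (u i l * u j k))) = 0"
  apply (cases g rule: gen_cases; erule idx_less_cases)
  apply (simp_all only: nf_expand)
  apply (simp_all only: nf_order smul_minus_left)
  by (rule poly_mapping_eqI; simp add: lookup_simps field_simps)+

lemma nf_det: "nf (u I1 I1 * (u I2 I2 * u I3 I3)) = nf 1 + \<rho>^6 *\<^sub>c nf (u I1 I1 * (u I2 I3 * u I3 I2))
    + \<rho>^6 *\<^sub>c nf (u I1 I2 * (u I2 I1 * u I3 I3))
    - \<rho>^12 *\<^sub>c nf (u I1 I2 * (u I2 I3 * u I3 I1)) - \<rho>^12 *\<^sub>c nf (u I1 I3 * (u I2 I1 * u I3 I2))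
    + \<rho>^18 *\<^sub>c nf (u I1 I3 * (u I2 I2 * u I3 I1))"
proof -
  have "nf (u I1 I1 * u I2 I2 * u I3 I3 - \<rho>^6 *\<^sub>c (u I1 I1 * u I2 I3 * u I3 I2) - \<rho>^6 *\<^sub>c (u I1 I2 * u I2 I1 * u I3 I3)
    + \<rho>^12 *\<^sub>c (u I1 I2 * u I2 I3 * u I3 I1) + \<rho>^12 *\<^sub>c (u I1 I3 * u I2 I1 * u I3 I2)
    - \<rho>^18 *\<^sub>c (u I1 I3 * u I2 I2 * u I3 I1) - 1) = 0"
    unfolding nf_eq_zero_iff by (rule genideal_base) (simp add: A_rels_alt)
  then show ?thesis by (simp add: nf_linear mult.assoc algebra_simps)
qed

text \<open>A diagonal generator scales the three rows by factors with product 1 and so fixes the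
  determinant. \<open>E\<close> or \<open>F\<close> turns it into a determinant with two equal rows,
  whose terms cancel in pairs by the exchange rule within a row.\<close>

lemma nf_act_det: "nf (act_free q (gen g) (u I1 I1 * u I2 I2 * u I3 I3 - \<rho>^6 *\<^sub>c (u I1 I1 * u I2 I3 * u I3 I2) - \<rho>^6 *\<^sub>c (u I1 I2 * u I2 I1 * u I3 I3)
    + \<rho>^12 *\<^sub>c (u I1 I2 * u I2 I3 * u I3 I1) + \<rho>^12 *\<^sub>c (u I1 I3 * u I2 I1 * u I3 I2)
    - \<rho>^18 *\<^sub>c (u I1 I3 * u I2 I2 * u I3 I1) - 1)) = 0"
  apply (cases g rule: gen_cases)
  apply (simp_all only: nf_expand mult.assoc)
  apply (simp_all only: nf_order nf_det smul_add smul_diff)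
  by (rule poly_mapping_eqI; simp add: lookup_simps field_simps)+

lemma act_free_gen_A_ideal: "a \<in> A_ideal q \<Longrightarrow> act_free q (gen g) a \<in> A_ideal q"
proof -
  assume "a \<in> A_ideal q"
  \<comment> \<open>All generators at once: the Leibniz rule for \<open>E\<close> or
    \<open>F\<close> on a product also applies \<open>K\<close> or its inverse to the factor in the
    ideal.\<close>
  then have "a \<in> A_ideal q \<and> (\<forall>g. act_free q (gen g) a \<in> A_ideal q)"
  proof (induction rule: genideal_induct)
    case (base r)
    have "nf (act_free q (gen g) r) = 0" for g
      using base
      by (cases rule: A_rels_cases) (simp_all only: nf_act_R1 nf_act_R2 nf_act_R3 nf_act_R4 nf_act_det)
    then show ?case using base by (simp add: nf_eq_zero_iff genideal_base)
  next
    case (left a x)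
    have "act_free q (gen g) (a * x) \<in> A_ideal q" for g
      using left by (cases g rule: gen_cases) (simp_all only: leibniz genideal_add genideal_mult_left)
    then show ?case using left by (simp add: genideal_mult_left)
  next
    case (right a x)
    have "act_free q (gen g) (x * a) \<in> A_ideal q" for g
      using right by (cases g rule: gen_cases) (simp_all only: leibniz genideal_add genideal_mult_right)
    then show ?case using right by (simp add: genideal_mult_right)
  qed (simp_all add: act_free_zero act_free_add genideal_zero genideal_add)
  then show ?thesis by blast
qed

lemma act_free_A_ideal: "a \<in> A_ideal q \<Longrightarrow> act_free q h a \<in> A_ideal q"
proof (induction h arbitrary: a rule: free_algebra_induct)
  case (scalar c)
  then show ?case by (simp add: scalar_alt act_free_simps genideal_smul)
qed (simp_all add: act_free_simps act_free_gen_A_ideal genideal_add)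

section \<open>Descent of the action to the quotients\<close>

lemma act_residue: "act q (ucl q h) (acl q a) = acl q (act_free q h a)"
proof -
  have "acl q (act_free q x y) = acl q (act_free q h a)" if xy: "x \<in> ucl q h" "y \<in> acl q a" for x y
  proof -
    obtain i where x: "x = i + h" "i \<in> U_ideal q"
      using xy(1) unfolding residue_alt by blast
    obtain j where y: "y = j + a" "j \<in> A_ideal q"
      using xy(2) unfolding residue_alt by blast
    from x y have "act_free q x y - act_free q h a = act_free q h j"
      by (simp add: act_free_add_left act_free_add act_free_U_ideal)
    then show ?thesis using y by (simp add: residue_eq_iff act_free_A_ideal)
  qed
  moreover have "h \<in> ucl q h" "a \<in> acl q a" by (rule residue_self)+
  ultimately show ?thesis unfolding act_def by (intro antisym UN_least) blast+
qed

lemma acl_eq_iff: "acl q x = acl q y \<longleftrightarrow> nf x = nf y"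
  unfolding residue_eq_iff nf_eq_zero_iff[symmetric] by (simp add: nf_diff)

lemma nf_nf [simp]: "nf (nf x) = nf x"
  using nf_diff_mem[of x] unfolding nf_eq_zero_iff[symmetric] by (simp add: nf_diff)

text \<open>The quotient action carried over to the representatives chosen by \<open>nf\<close>:
  equations between cosets become equations in the free algebra, where coefficients can be
  compared.\<close>

definition nact :: "ufree \<Rightarrow> afree \<Rightarrow> afree" where
  "nact h x = nf (act_free q h x)"

lemma nf_act_free_nf: "nf (act_free q h (nf x)) = nf (act_free q h x)"
proof -
  have "act_free q h (x - nf x) \<in> A_ideal q" by (intro act_free_A_ideal nf_diff_mem)
  then show ?thesis unfolding nf_eq_zero_iff[symmetric] by (simp add: act_free_diff nf_diff)
qed

lemma nact_nact: "nact g (nact h x) = nf (act_free q g (act_free q h x))"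
  by (simp add: nact_def nf_act_free_nf)

lemma nact_linear:
  "nact h (x + y) = nact h x + nact h y" "nact h (c *\<^sub>c x) = c *\<^sub>c nact h x" "nact h (x - y) = nact h x - nact h y"
  "nact h (- x) = - nact h x" "nact h 0 = 0"
  by (simp_all add: nact_def act_free_add act_free_smul act_free_diff act_free_minus act_free_zero nf_linear)

lemma nact_alg:
  "nact (g + h) x = nact g x + nact h x" "nact (c *\<^sub>c h) x = c *\<^sub>c nact h x" "nact (g - h) x = nact g x - nact h x"
  "nact (- h) x = - nact h x" "nact (g * h) x = nact g (nact h x)" "nact 1 x = nf x"
  by (simp_all add: nact_nact act_free_mult) (simp_all add: nact_def act_free_simps nf_linear)

lemma nf_nact [simp]: "nf (nact h x) = nact h x"
  by (simp add: nact_def)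

section \<open>Weights and the Casimir element\<close>

text \<open>\<open>H\<close> is group-like with a positive diagonal matrix, so every letter
  contributes a positive factor.\<close>

lemma single_h_eigen: "\<exists>m>0. \<forall>c. h1 (Poly_Mapping.single w c) = of_real m *\<^sub>c Poly_Mapping.single w c"
proof (induction w)
  case Nil
  show ?case by (intro exI[of _ 1]) (simp add: single_Nil ops_scalar)
next
  case (Cons ij w)
  then obtain m where m: "m > 0" "\<And>c. h1 (Poly_Mapping.single w c) = of_real m *\<^sub>c Poly_Mapping.single w c"
    by blast
  obtain i j where ij: "ij = (i, j)" by fastforce
  define n where "n = (case i of I1 \<Rightarrow> q powr (- 1 / 3) | I2 \<Rightarrow> q powr (2 / 3) | I3 \<Rightarrow> q powr (- 1 / 3))"
  have "n > 0" using q_pos by (cases i) (simp_all add: n_def)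
  moreover have "h1 (u i j * Poly_Mapping.single w c) = of_real (n * m) *\<^sub>c (u i j * Poly_Mapping.single w c)" for c
    by (cases i) (simp_all add: ops_Cons m n_def smul_mult_right powr_rho)
  ultimately show ?case using m(1) by (intro exI[of _ "n * m"]) (simp add: ij single_Cons)
qed

text \<open>\<open>foldr Hm ms\<close> is the product of the commuting operators
  \<open>H - m\<close>, that is, a polynomial in \<open>H\<close> with roots
  \<open>ms\<close>.\<close>

abbreviation "Hm m x \<equiv> nact H x - of_real m *\<^sub>c x"

lemma foldr_Hm_linear:
  "foldr Hm ms (x + y) = foldr Hm ms x + foldr Hm ms y"
  "foldr Hm ms (c *\<^sub>c x) = c *\<^sub>c foldr Hm ms x"
  "foldr Hm ms (x - y) = foldr Hm ms x - foldr Hm ms y"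
  by (induction ms) (simp_all add: nact_linear smul_add smul_diff mult.commute)

lemma foldr_Hm_zero: "foldr Hm ms 0 = 0"
  by (induction ms) (simp_all add: nact_linear)

lemma foldr_Hm_commute: "foldr Hm ms (nact H x) = nact H (foldr Hm ms x)"
  by (induction ms) (simp_all add: nact_linear)

lemma foldr_Hm_foldr: "foldr Hm ms (foldr Hm ns x) = foldr Hm ns (foldr Hm ms x)"
  by (induction ns) (simp_all add: foldr_Hm_linear foldr_Hm_commute)

lemma H_annihilated: "\<exists>ms. (\<forall>m\<in>set ms. m > 0) \<and> foldr Hm ms (nf x) = 0"
proof (induction x rule: poly_mapping_add_induct)
  case (single w c)
  obtain m where m: "m > 0" "h1 (Poly_Mapping.single w c) = of_real m *\<^sub>c Poly_Mapping.single w c"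
    using single_h_eigen by blast
  then have "Hm m (nf (Poly_Mapping.single w c)) = 0"
    by (simp add: nact_def nf_act_free_nf nf_linear)
  with m(1) show ?case by (intro exI[of _ "[m]"]) simp
next
  case (add x y)
  then obtain ms ns where ms: "\<forall>m\<in>set ms. m > 0" "foldr Hm ms (nf x) = 0"
    and ns: "\<forall>m\<in>set ns. m > 0" "foldr Hm ns (nf y) = 0" by blast
  \<comment> \<open>Since the factors commute, the product over both lists kills both
    summands.\<close>
  have "foldr Hm (ms @ ns) (nf (x + y)) = foldr Hm ns (foldr Hm ms (nf x)) + foldr Hm ms (foldr Hm ns (nf y))"
    by (simp add: foldr_Hm_linear nf_linear foldr_Hm_foldr[of ms ns])
  also have "\<dots> = 0" by (simp add: ms ns foldr_Hm_zero)
  finally show ?case using ms ns by (intro exI[of _ "ms @ ns"]) auto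
qed

text \<open>At an eigenvalue \<open>m > 0\<close> the quadratic takes the positive value
  \<open>m^2 + t * m + t^2\<close>. It is therefore injective on elements killed by finitely many
  factors \<open>H - m\<close>, which are removed one at a time.\<close>

lemma H_quadratic_zero:
  assumes "\<forall>m\<in>set ms. m > 0" "foldr Hm ms b = 0"
    and "nact H (nact H b) + of_real t *\<^sub>c nact H b + of_real (t^2) *\<^sub>c b = 0" and "t > 0"
  shows "b = 0"
  using assms(1,2)
proof (induction ms)
  case (Cons m ms)
  define b' where "b' = foldr Hm ms b"
  have H: "nact H b' = of_real m *\<^sub>c b'"
    using Cons.prems(2) by (simp add: b'_def)
  have "nact H (nact H b') + of_real t *\<^sub>c nact H b' + of_real (t^2) *\<^sub>c b' =
     foldr Hm ms (nact H (nact H b) + of_real t *\<^sub>c nact H b + of_real (t^2) *\<^sub>c b)"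
    by (simp only: foldr_Hm_linear foldr_Hm_commute b'_def)
  also have "\<dots> = 0" by (simp only: assms(3) foldr_Hm_zero)
  finally have "of_real (m^2 + t * m + t^2) *\<^sub>c b' = 0"
    by (simp add: H nact_linear power2_eq_square smul_add_left)
  moreover have "m^2 + t * m + t^2 > 0"
    using Cons.prems(1) \<open>t > 0\<close> by (simp add: add_pos_pos)
  then have "complex_of_real (m^2 + t * m + t^2) \<noteq> 0"
    by (metis less_irrefl of_real_eq_0_iff)
  ultimately have "b' = 0" by simp
  then show ?case using Cons by (simp add: b'_def)
qed simp

text \<open>\<open>H\<close> has positive eigenvalues on words, so it is determined by its cube.\<close>

lemma H_cube_root:
  assumes x: "nf x = x" and cube: "nact H (nact H (nact H x)) = of_real (t^3) *\<^sub>c x" and "t > 0"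
  shows "nact H x = of_real t *\<^sub>c x"
proof -
  obtain ms where ms: "\<forall>m\<in>set ms. m > 0" "foldr Hm ms x = 0" using H_annihilated[of x] x by auto
  have "foldr Hm ms (Hm t x) = 0"
    by (simp add: foldr_Hm_linear foldr_Hm_commute ms nact_linear)
  \<comment> \<open>The factorization \<open>H^3 - t^3 = (H^2 + t * H + t^2) * (H - t)\<close>,
    applied to \<open>x\<close>.\<close>
  moreover have "nact H (nact H (Hm t x)) + of_real t *\<^sub>c nact H (Hm t x) + of_real (t^2) *\<^sub>c Hm t x = 0"
    by (simp add: nact_linear cube smul_diff power3_eq_cube power2_eq_square)
  ultimately have "Hm t x = 0" by (rule H_quadratic_zero[OF ms(1) _ _ \<open>t > 0\<close>])
  then show ?thesis by simp
qed

section \<open>Weight vectors and commutators\<close>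

abbreviation "me1 \<equiv> nact (E N1)"
abbreviation "me2 \<equiv> nact (E N2)"
abbreviation "mf1 \<equiv> nact (F N1)"
abbreviation "mf2 \<equiv> nact (F N2)"
abbreviation "mk1 \<equiv> nact (K N1)"
abbreviation "mk2 \<equiv> nact (K N2)"
abbreviation "mk1i \<equiv> nact (Ki N1)"
abbreviation "mk2i \<equiv> nact (Ki N2)"
abbreviation "mh \<equiv> nact H"
abbreviation "mhi \<equiv> nact Hi"

text \<open>Only the square of \<open>mk2\<close> gets an eigenvalue: forms are eigenvectors of
  \<open>K N1\<close> and of \<open>K N1 * (K N2)^2\<close>, and the commutators and the Casimir
  element contain \<open>K N2\<close> to even powers only.\<close>

definition wt :: "complex \<Rightarrow> complex \<Rightarrow> complex \<Rightarrow> afree \<Rightarrow> bool" where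
  "wt a b c x \<longleftrightarrow> mk1 x = a *\<^sub>c x \<and> mk1i x = (1 / a) *\<^sub>c x \<and> mk2 (mk2 x) = b *\<^sub>c x \<and>
     mk2i (mk2i x) = (1 / b) *\<^sub>c x \<and> mh x = c *\<^sub>c x \<and> mhi x = (1 / c) *\<^sub>c x"

lemma nact_weights:
  "mk1 (me1 x) = \<rho>^6 *\<^sub>c me1 (mk1 x)" "mk1i (me1 x) = (1 / \<rho>^6) *\<^sub>c me1 (mk1i x)"
  "mk2 (me1 x) = (1 / \<rho>^3) *\<^sub>c me1 (mk2 x)" "mk2i (me1 x) = \<rho>^3 *\<^sub>c me1 (mk2i x)"
  "mh (me1 x) = \<rho>^6 *\<^sub>c me1 (mh x)" "mhi (me1 x) = (1 / \<rho>^6) *\<^sub>c me1 (mhi x)"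
  "mk2 (me2 x) = \<rho>^6 *\<^sub>c me2 (mk2 x)" "mk2i (me2 x) = (1 / \<rho>^6) *\<^sub>c me2 (mk2i x)"
  "mk1 (me2 x) = (1 / \<rho>^3) *\<^sub>c me2 (mk1 x)" "mk1i (me2 x) = \<rho>^3 *\<^sub>c me2 (mk1i x)"
  "mh (me2 x) = (1 / \<rho>^6) *\<^sub>c me2 (mh x)" "mhi (me2 x) = \<rho>^6 *\<^sub>c me2 (mhi x)"
  "mk1 (mf1 x) = (1 / \<rho>^6) *\<^sub>c mf1 (mk1 x)" "mk1i (mf1 x) = \<rho>^6 *\<^sub>c mf1 (mk1i x)"
  "mk2 (mf1 x) = \<rho>^3 *\<^sub>c mf1 (mk2 x)" "mk2i (mf1 x) = (1 / \<rho>^3) *\<^sub>c mf1 (mk2i x)"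
  "mh (mf1 x) = (1 / \<rho>^6) *\<^sub>c mf1 (mh x)" "mhi (mf1 x) = \<rho>^6 *\<^sub>c mf1 (mhi x)"
  "mk2 (mf2 x) = (1 / \<rho>^6) *\<^sub>c mf2 (mk2 x)" "mk2i (mf2 x) = \<rho>^6 *\<^sub>c mf2 (mk2i x)"
  "mk1 (mf2 x) = \<rho>^3 *\<^sub>c mf2 (mk1 x)" "mk1i (mf2 x) = (1 / \<rho>^3) *\<^sub>c mf2 (mk1i x)"
  "mh (mf2 x) = \<rho>^6 *\<^sub>c mf2 (mh x)" "mhi (mf2 x) = (1 / \<rho>^6) *\<^sub>c mf2 (mhi x)"
  by (simp_all add: nact_nact weights nf_linear)

lemma wt_ops:
  assumes "wt a b c x"
  shows wt_e1: "wt (\<rho>^6 * a) (b / \<rho>^6) (\<rho>^6 * c) (me1 x)"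
    and wt_e2: "wt (a / \<rho>^3) (\<rho>^12 * b) (c / \<rho>^6) (me2 x)"
    and wt_f1: "wt (a / \<rho>^6) (\<rho>^6 * b) (c / \<rho>^6) (mf1 x)"
    and wt_f2: "wt (\<rho>^3 * a) (b / \<rho>^12) (\<rho>^6 * c) (mf2 x)"
  using assms unfolding wt_def by (simp_all add: nact_weights nact_linear)

lemma wt_linear:
  "wt a b c x \<Longrightarrow> wt a b c y \<Longrightarrow> wt a b c (x + y)"
  "wt a b c x \<Longrightarrow> wt a b c y \<Longrightarrow> wt a b c (x - y)"
  "wt a b c x \<Longrightarrow> wt a b c (- x)"
  "wt a b c x \<Longrightarrow> wt a b c (d *\<^sub>c x)"
  unfolding wt_def by (simp_all add: nact_linear smul_add smul_diff smul_minus mult.commute)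

lemma nact_ef_comm: "me1 (mf2 x) = mf2 (me1 x)" "me2 (mf1 x) = mf1 (me2 x)"
  by (simp_all add: nact_nact ef_comm)

text \<open>For \<open>a\<close> = q^(m/2) the scalar is the q-number [m].\<close>

lemma nact_ef_1: "wt a b c x \<Longrightarrow> me1 (mf1 x) = mf1 (me1 x) + (\<delta> * (a^2 - 1 / a^2)) *\<^sub>c x"
proof -
  assume w: "wt a b c x"
  have "me1 (mf1 x) = mf1 (me1 x) + \<delta> *\<^sub>c (mk1 (mk1 x) - mk1i (mk1i x))"
    by (simp add: nact_nact ef_diag_1 nf_linear)
  with w show ?thesis unfolding wt_def
    by (simp add: nact_linear power2_eq_square smul_diff smul_diff_left right_diff_distrib)
qed

lemma nact_ef_2: "wt a b c x \<Longrightarrow> me2 (mf2 x) = mf2 (me2 x) + (\<delta> * (b - 1 / b)) *\<^sub>c x"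
proof -
  assume w: "wt a b c x"
  have "me2 (mf2 x) = mf2 (me2 x) + \<delta> *\<^sub>c (mk2 (mk2 x) - mk2i (mk2i x))"
    by (simp add: nact_nact ef_diag_2 nf_linear)
  with w show ?thesis unfolding wt_def
    by (simp add: smul_diff smul_diff_left right_diff_distrib)
qed

lemma nact_serre:
  "me1 (me1 (me2 x)) = (\<rho>^6 + 1 / \<rho>^6) *\<^sub>c me1 (me2 (me1 x)) - me2 (me1 (me1 x))"
  "me2 (me2 (me1 x)) = (\<rho>^6 + 1 / \<rho>^6) *\<^sub>c me2 (me1 (me2 x)) - me1 (me2 (me2 x))"
  "mf1 (mf1 (mf2 x)) = (\<rho>^6 + 1 / \<rho>^6) *\<^sub>c mf1 (mf2 (mf1 x)) - mf2 (mf1 (mf1 x))"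
  "mf2 (mf2 (mf1 x)) = (\<rho>^6 + 1 / \<rho>^6) *\<^sub>c mf2 (mf1 (mf2 x)) - mf1 (mf2 (mf2 x))"
  by (simp_all only: nact_nact nf_act_free_nf nact_def serre nf_linear)

section \<open>The Casimir element on weight vectors\<close>

definition casimir_free :: ufree where
  "casimir_free = scalar (1 / (q - 1 / q)^2) *
       ((H + Hi) * ((scalar q * K N1 * K N2)^2 + (scalar (1 / q) * Ki N2 * Ki N1)^2)
        + H^2 + Hi^2 - 6)
     + (scalar q * H * (K N2)^2 + scalar (1 / q) * Hi * (Ki N2)^2) * F N1 * E N1
     + (scalar q * Hi * (K N1)^2 + scalar (1 / q) * H * (Ki N1)^2) * F N2 * E N2
     + scalar q * H * qcomm q (F N2) (F N1) * qcomm q (E N1) (E N2)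
     + scalar q * Hi * qcomm q (F N1) (F N2) * qcomm q (E N2) (E N1)"

lemma wt_M:
  assumes "wt a b c x"
  shows "mk1 x = a *\<^sub>c x" "mk1i x = (1 / a) *\<^sub>c x" "mk2 (mk2 x) = b *\<^sub>c x" "mk2i (mk2i x) = (1 / b) *\<^sub>c x"
    "mh x = c *\<^sub>c x" "mhi x = (1 / c) *\<^sub>c x"
  using assms by (simp_all add: wt_def)

lemma nact_comm: "mk2 (mk1 x) = mk1 (mk2 x)" "mk2i (mk1i x) = mk1i (mk2i x)" "mk1 (mk1i x) = nf x" "mk2 (mk2i x) = nf x"
  "mk1i (mk1 x) = nf x" "mk2i (mk2 x) = nf x" "mh (mhi x) = nf x" "mhi (mh x) = nf x"
  by (simp_all add: nact_nact diag_comm diag_inv)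

text \<open>Each operator lowers by exactly what it has raised. The Cartan factors of the Casimir
  element stand to the left of these operators and hence act by the scalars of \<open>x\<close>
  itself.\<close>

lemma wt_loops:
  assumes w: "wt a b c x"
  shows "wt a b c (mf1 (me1 x))" "wt a b c (mf2 (me2 x))"
    "wt a b c (mf1 (mf2 (me1 (me2 x))))" "wt a b c (mf2 (mf1 (me1 (me2 x))))"
    "wt a b c (mf1 (mf2 (me2 (me1 x))))" "wt a b c (mf2 (mf1 (me2 (me1 x))))"
  using wt_f1[OF wt_e1[OF w]] wt_f2[OF wt_e2[OF w]]
    wt_f1[OF wt_f2[OF wt_e1[OF wt_e2[OF w]]]] wt_f2[OF wt_f1[OF wt_e1[OF wt_e2[OF w]]]]
    wt_f1[OF wt_f2[OF wt_e2[OF wt_e1[OF w]]]] wt_f2[OF wt_f1[OF wt_e2[OF wt_e1[OF w]]]]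
  by simp_all

lemma nact_casimir:
  assumes w: "wt a b c x" and nz: "a \<noteq> 0" "b \<noteq> 0" "c \<noteq> 0" and x: "nf x = x"
  shows "nact casimir_free x =
    (\<delta>^2 * ((c + 1 / c) * (\<rho>^12 * a^2 * b + 1 / (\<rho>^12 * a^2 * b)) + c^2 + 1 / c^2 - 6)) *\<^sub>c x
    + (\<rho>^6 * c * b + 1 / (\<rho>^6 * c * b)) *\<^sub>c mf1 (me1 x)
    + (\<rho>^6 * a^2 / c + c / (\<rho>^6 * a^2)) *\<^sub>c mf2 (me2 x)
    + (\<rho>^6 * c) *\<^sub>c (mf2 (mf1 (me1 (me2 x))) - (1 / \<rho>^6) *\<^sub>c mf1 (mf2 (me1 (me2 x)))
       - (1 / \<rho>^6) *\<^sub>c mf2 (mf1 (me2 (me1 x))) + (1 / \<rho>^12) *\<^sub>c mf1 (mf2 (me2 (me1 x))))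
    + (\<rho>^6 / c) *\<^sub>c (mf1 (mf2 (me2 (me1 x))) - (1 / \<rho>^6) *\<^sub>c mf2 (mf1 (me2 (me1 x)))
       - (1 / \<rho>^6) *\<^sub>c mf1 (mf2 (me1 (me2 x))) + (1 / \<rho>^12) *\<^sub>c mf2 (mf1 (me1 (me2 x))))"
proof -
  have d: "complex_of_real (1 / (q - 1 / q)\<^sup>2) = \<delta>^2"
    using q_pos rho_power_12 by (simp add: powr_rho \<delta>_def field_simps power2_eq_square)
  have s: "complex_of_real (1 / q) = 1 / \<rho>^6" by (simp add: powr_rho)
  note W = wt_M[OF w] wt_M[OF wt_loops(1)[OF w]] wt_M[OF wt_loops(2)[OF w]] wt_M[OF wt_loops(3)[OF w]]
    wt_M[OF wt_loops(4)[OF w]] wt_M[OF wt_loops(5)[OF w]] wt_M[OF wt_loops(6)[OF w]]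
  have "nact casimir_free x = \<delta>^2 *\<^sub>c ((c + 1 / c) *\<^sub>c (\<rho>^12 * a^2 * b + 1 / (\<rho>^12 * a^2 * b)) *\<^sub>c x + c^2 *\<^sub>c x + (1 / c^2) *\<^sub>c x - 6 *\<^sub>c x)
    + ((\<rho>^6 * c * b) *\<^sub>c mf1 (me1 x) + (1 / (\<rho>^6 * c * b)) *\<^sub>c mf1 (me1 x))
    + ((\<rho>^6 * a^2 / c) *\<^sub>c mf2 (me2 x) + (c / (\<rho>^6 * a^2)) *\<^sub>c mf2 (me2 x))
    + (\<rho>^6 * c) *\<^sub>c (mf2 (mf1 (me1 (me2 x))) - (1 / \<rho>^6) *\<^sub>c mf1 (mf2 (me1 (me2 x)))
       - (1 / \<rho>^6) *\<^sub>c mf2 (mf1 (me2 (me1 x))) + (1 / \<rho>^12) *\<^sub>c mf1 (mf2 (me2 (me1 x))))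
    + (\<rho>^6 / c) *\<^sub>c (mf1 (mf2 (me2 (me1 x))) - (1 / \<rho>^6) *\<^sub>c mf2 (mf1 (me2 (me1 x)))
       - (1 / \<rho>^6) *\<^sub>c mf1 (mf2 (me1 (me2 x))) + (1 / \<rho>^12) *\<^sub>c mf2 (mf1 (me1 (me2 x))))"
    \<comment> \<open>The numeral 6 is turned into a multiple of 1, since \<open>nact_alg\<close>
      evaluates constants only in this form.\<close>
    unfolding casimir_free_def qcomm_def d s scalar_mult powr_rho numeral_alt[of "num.Bit0 (num.Bit1 num.One)"]
    by (simp only: power2_eq_square[where 'a = ufree] nact_alg nact_linear x nact_comm W smul_smul smul_mult_left smul_mult_right
       distrib_right left_diff_distrib)
      (rule poly_mapping_eqI, simp add: lookup_simps field_simps nz power2_eq_square)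
  then show ?thesis by (simp only: smul_smul smul_add_left[symmetric] smul_diff_left[symmetric])
qed

text \<open>The q-number [2], see \<open>qnum_qtwo\<close>. It is also the coefficient in the Serre
  relations, where it cancels the factors \<open>2 / qtwo\<close> from X and Y.\<close>

definition qtwo :: complex where "qtwo = \<rho>^6 + 1 / \<rho>^6"

lemma qtwo_real: "qtwo = of_real (q + 1 / q)"
  by (simp add: qtwo_def powr_rho)

lemma qtwo_nz: "qtwo \<noteq> 0"
proof -
  have "q + 1 / q > 0" using q_pos by (simp add: add_pos_pos)
  then show "qtwo \<noteq> 0" unfolding qtwo_real by (metis less_irrefl of_real_eq_0_iff)
qed

lemma delta_1: "\<delta> * (\<rho>^6 - 1 / \<rho>^6) = 1"
proof -
  have "\<rho>^6 - 1 / \<rho>^6 = (\<rho>^12 - 1) / \<rho>^6" by (simp add: field_simps)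
  then show ?thesis using rho_power_12 by (simp add: \<delta>_def)
qed

lemma delta_2: "\<delta> * (\<rho>^12 - 1 / \<rho>^12) = qtwo"
proof -
  have "\<rho>^12 - 1 / \<rho>^12 = (\<rho>^6 - 1 / \<rho>^6) * qtwo" by (simp add: qtwo_def field_simps)
  then show ?thesis using delta_1 by (simp add: mult.assoc[symmetric])
qed

text \<open>The value is [3], written as [2]^2 - 1 so that the Laplacians involve only
  \<open>qtwo\<close>.\<close>

lemma delta_3: "\<delta> * (\<rho>^18 - 1 / \<rho>^18) = qtwo^2 - 1"
proof -
  have "\<rho>^18 - 1 / \<rho>^18 = (\<rho>^6 - 1 / \<rho>^6) * (qtwo^2 - 1)"
    by (simp add: qtwo_def field_simps power2_eq_square)
  then show ?thesis using delta_1 by (simp add: mult.assoc[symmetric])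
qed

text \<open>Cancels the prefactor of the Casimir element once its Cartan bracket is
  factored.\<close>

lemma delta_square: "\<delta>^2 * ((\<rho>^6 - 1 / \<rho>^6)^2 * R) = R"
proof -
  have "\<delta>^2 * ((\<rho>^6 - 1 / \<rho>^6)^2 * R) = (\<delta> * (\<rho>^6 - 1 / \<rho>^6))^2 * R"
    by (simp only: power_mult_distrib mult_ac)
  then show ?thesis by (simp add: delta_1)
qed

text \<open>In each triple of eigenvalues \<open>a\<close>, \<open>b\<close>, \<open>c\<close> the last is the positive cube root of
  \<open>a\<^sup>2 / b\<close>, as forced by \<open>H\<^sup>3 = (K\<^sub>1 K\<^sub>2\<^sup>-\<^sup>1)\<^sup>2\<close>.\<close>

definition form0 :: "afree \<Rightarrow> bool" where
  "form0 a \<longleftrightarrow> nf a = a \<and> wt 1 1 1 a \<and> me1 a = 0 \<and> mf1 a = 0"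

definition form1 :: "afree \<Rightarrow> afree \<Rightarrow> bool" where
  "form1 x y \<longleftrightarrow> nf x = x \<and> nf y = y \<and> wt (\<rho>^3) (\<rho>^6) 1 x \<and> wt (1 / \<rho>^3) (\<rho>^12) (1 / \<rho>^6) y \<and>
     me1 x = 0 \<and> me1 y = x \<and> mf1 x = y \<and> mf1 y = 0"

definition form2 :: "afree \<Rightarrow> bool" where
  "form2 b \<longleftrightarrow> nf b = b \<and> wt 1 (\<rho>^18) (1 / \<rho>^6) b \<and> me1 b = 0 \<and> mf1 b = 0"

section \<open>Singlets, doublets and the images of forms\<close>

lemma nact_ef_comm': "mf2 (me1 x) = me1 (mf2 x)" "mf1 (me2 x) = me2 (mf1 x)"
  by (simp_all add: nact_ef_comm)

text \<open>From the singlet \<open>a\<close>, \<open>me2 a\<close> is the lowest vector of a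
  doublet with upper vector \<open>me1 (me2 a)\<close>: \<open>F N1\<close> commutes with
  \<open>E N2\<close>, and raising twice gives zero by the Serre relation. The next lemma is the
  mirror image, with highest vector \<open>mf2 a\<close>.\<close>

lemma invariant_e2:
  assumes w: "wt 1 b c a" and z: "me1 a = 0" "mf1 a = 0"
  shows "mf1 (me1 (me2 a)) = me2 a" "me1 (me1 (me2 a)) = 0" "mf1 (me2 a) = 0"
proof -
  show f: "mf1 (me2 a) = 0" by (simp add: nact_ef_comm' z nact_linear)
  have "\<delta> * ((1 / \<rho>^3)^2 - 1 / (1 / \<rho>^3)^2) = - (\<delta> * (\<rho>^6 - 1 / \<rho>^6))"
    by (simp add: field_simps)
  then have "\<delta> * ((1 / \<rho>^3)^2 - 1 / (1 / \<rho>^3)^2) = - 1"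
    by (simp only: delta_1)
  then show "mf1 (me1 (me2 a)) = me2 a"
    using nact_ef_1[OF wt_e2[OF w]] by (simp only: f nact_linear) (simp add: smul_minus_left)
  show "me1 (me1 (me2 a)) = 0"
    by (simp add: nact_serre z nact_linear)
qed

lemma invariant_f2:
  assumes w: "wt 1 b c a" and z: "me1 a = 0" "mf1 a = 0"
  shows "me1 (mf1 (mf2 a)) = mf2 a" "mf1 (mf1 (mf2 a)) = 0" "me1 (mf2 a) = 0"
proof -
  show f: "me1 (mf2 a) = 0" by (simp add: nact_ef_comm z nact_linear)
  have "\<delta> * ((\<rho>^3 * 1)^2 - 1 / (\<rho>^3 * 1)^2) = 1"
    using delta_1 by simp
  then show "me1 (mf1 (mf2 a)) = mf2 a"
    using nact_ef_1[OF wt_f2[OF w]] by (simp only: f nact_linear) simp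
  show "mf1 (mf1 (mf2 a)) = 0"
    by (simp add: nact_serre z nact_linear)
qed

text \<open>Applying \<open>me2\<close> or \<open>mf2\<close> to the doublet \<open>x\<close>,
  \<open>y\<close> leads to a triplet and a singlet. The triplets have highest vector
  \<open>mf2 x\<close> and lowest vector \<open>me2 y\<close>, on which the commutator scalars are
  [2] and -[2].\<close>

lemma form1_facts:
  assumes "form1 x y"
  shows "mf1 (me2 x) = me2 y" "me1 (mf2 x) = 0" "mf1 (me2 y) = 0" "me1 (mf2 y) = mf2 x"
    "me1 (mf1 (mf2 x)) = qtwo *\<^sub>c mf2 x" "mf1 (mf1 (mf2 x)) = qtwo *\<^sub>c mf1 (mf2 y)"
    "mf1 (me1 (me2 y)) = qtwo *\<^sub>c me2 y" "me1 (me1 (me2 y)) = qtwo *\<^sub>c me1 (me2 x)"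
    "mf1 (me1 (me2 x)) = me1 (me2 y)"
proof -
  have w: "wt (\<rho>^3) (\<rho>^6) 1 x" "wt (1 / \<rho>^3) (\<rho>^12) (1 / \<rho>^6) y"
    and z: "me1 x = 0" "me1 y = x" "mf1 x = y" "mf1 y = 0" using assms by (simp_all add: form1_def)
  show fx: "mf1 (me2 x) = me2 y" and fy: "mf1 (me2 y) = 0" by (simp_all add: nact_ef_comm' z nact_linear)
  show ex: "me1 (mf2 x) = 0" and "me1 (mf2 y) = mf2 x" by (simp_all add: nact_ef_comm z nact_linear)
  have "\<delta> * ((\<rho>^3 * \<rho>^3)^2 - 1 / (\<rho>^3 * \<rho>^3)^2) = qtwo"
    using delta_2 by (simp flip: power_add power_mult)
  then show "me1 (mf1 (mf2 x)) = qtwo *\<^sub>c mf2 x"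
    using nact_ef_1[OF wt_f2[OF w(1)]] by (simp only: ex nact_linear) simp
  have "\<delta> * ((1 / \<rho>^3 / \<rho>^3)^2 - 1 / (1 / \<rho>^3 / \<rho>^3)^2) = - (\<delta> * (\<rho>^12 - 1 / \<rho>^12))"
    by (simp add: field_simps)
  then have "\<delta> * ((1 / \<rho>^3 / \<rho>^3)^2 - 1 / (1 / \<rho>^3 / \<rho>^3)^2) = - qtwo"
    by (simp only: delta_2)
  then show "mf1 (me1 (me2 y)) = qtwo *\<^sub>c me2 y"
    using nact_ef_1[OF wt_e2[OF w(2)]] by (simp only: fy nact_linear) (simp add: smul_minus_left)
  show "mf1 (mf1 (mf2 x)) = qtwo *\<^sub>c mf1 (mf2 y)" "me1 (me1 (me2 y)) = qtwo *\<^sub>c me1 (me2 x)"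
    by (simp_all add: nact_serre z nact_linear qtwo_def)
  \<comment> \<open>\<open>me2 x\<close> has \<open>K N1\<close>-eigenvalue 1, so the commutator
    scalar is [0] = 0.\<close>
  have "\<delta> * ((\<rho>^3 / \<rho>^3)^2 - 1 / (\<rho>^3 / \<rho>^3)^2) = 0" by simp
  then show "mf1 (me1 (me2 x)) = me1 (me2 y)"
    using nact_ef_1[OF wt_e2[OF w(1)]] by (simp only: fx) simp
qed

text \<open>The factor \<open>2 / qtwo\<close> selects the singlet: raising turns both terms into
  \<open>2 *\<^sub>c mf2 x\<close>, and lowering turns both into
  \<open>2 *\<^sub>c mf1 (mf2 y)\<close>.\<close>

lemma form0_image:
  assumes "form1 x y"
  shows "form0 (2 *\<^sub>c mf2 y - (2 / qtwo) *\<^sub>c mf1 (mf2 x))"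
proof -
  have w: "wt (\<rho>^3) (\<rho>^6) 1 x" "wt (1 / \<rho>^3) (\<rho>^12) (1 / \<rho>^6) y" using assms by (simp_all add: form1_def)
  have "wt 1 1 1 (mf2 y)" "wt 1 1 1 (mf1 (mf2 x))"
    using wt_f2[OF w(2)] wt_f1[OF wt_f2[OF w(1)]] by (simp_all flip: power_add)
  then show ?thesis unfolding form0_def
    by (simp add: wt_linear nf_linear nact_linear form1_facts[OF assms] qtwo_nz)
qed

lemma form1_image:
  assumes a: "form0 a" and b: "form2 b"
  shows "form1 (me1 (me2 a) - s *\<^sub>c mf2 b) (me2 a - s *\<^sub>c mf1 (mf2 b))"
proof -
  have w: "wt 1 1 1 a" "wt 1 (\<rho>^18) (1 / \<rho>^6) b" and z: "me1 a = 0" "mf1 a = 0" "me1 b = 0" "mf1 b = 0"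
    using a b by (simp_all add: form0_def form2_def)
  have "\<rho>^18 / \<rho>^12 = \<rho>^6" "\<rho>^12 / \<rho>^6 = \<rho>^6" "\<rho>^6 / \<rho>^3 = \<rho>^3" "\<rho>^3 / \<rho>^6 = 1 / \<rho>^3" "\<rho>^6 * \<rho>^6 = \<rho>^12" by (simp_all add: field_simps)
  then have "wt (\<rho>^3) (\<rho>^6) 1 (me1 (me2 a))" "wt (1 / \<rho>^3) (\<rho>^12) (1 / \<rho>^6) (me2 a)"
    "wt (\<rho>^3) (\<rho>^6) 1 (mf2 b)" "wt (1 / \<rho>^3) (\<rho>^12) (1 / \<rho>^6) (mf1 (mf2 b))"
    using wt_e1[OF wt_e2[OF w(1)]] wt_e2[OF w(1)] wt_f2[OF w(2)] wt_f1[OF wt_f2[OF w(2)]] by simp_all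
  then show ?thesis unfolding form1_def
    by (simp add: wt_linear nf_linear nact_linear invariant_e2[OF w(1) z(1,2)] invariant_f2[OF w(2) z(3,4)])
qed

lemma form2_image:
  assumes "form1 x y"
  shows "form2 (s *\<^sub>c ((2 / qtwo) *\<^sub>c me1 (me2 y) - 2 *\<^sub>c me2 x))"
proof -
  have w: "wt (\<rho>^3) (\<rho>^6) 1 x" "wt (1 / \<rho>^3) (\<rho>^12) (1 / \<rho>^6) y" using assms by (simp_all add: form1_def)
  have "\<rho>^6 / \<rho>^12 = 1 / \<rho>^6" "\<rho>^24 / \<rho>^6 = \<rho>^18" by (simp_all add: field_simps)
  then have "wt 1 (\<rho>^18) (1 / \<rho>^6) (me2 x)" "wt 1 (\<rho>^18) (1 / \<rho>^6) (me1 (me2 y))"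
    using wt_e2[OF w(1)] wt_e1[OF wt_e2[OF w(2)]] by (simp_all flip: power_add)
  then show ?thesis unfolding form2_def
    by (simp add: wt_linear nf_linear nact_linear form1_facts[OF assms] qtwo_nz)
qed

text \<open>The squares of the differential and of its adjoint vanish: with
  \<open>me1 a = 0\<close>, the Serre relation quadratic in \<open>E N2\<close> loses a term and
  becomes a proportionality with factor [2], and likewise for \<open>b\<close>.\<close>

lemma form0_square:
  assumes "form0 a" "form2 b"
  shows "2 *\<^sub>c mf2 (mf1 (mf2 b)) - (2 / qtwo) *\<^sub>c mf1 (mf2 (mf2 b)) = 0"
    and "(2 / qtwo) *\<^sub>c me1 (me2 (me2 a)) - 2 *\<^sub>c me2 (me1 (me2 a)) = 0"
proof -
  have z: "me1 a = 0" "mf1 b = 0" using assms by (simp_all add: form0_def form2_def)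
  have "mf1 (mf2 (mf2 b)) = qtwo *\<^sub>c mf2 (mf1 (mf2 b))" "me1 (me2 (me2 a)) = qtwo *\<^sub>c me2 (me1 (me2 a))"
    using nact_serre(2)[of a] nact_serre(4)[of b] by (simp_all add: z nact_linear qtwo_def)
  then show "2 *\<^sub>c mf2 (mf1 (mf2 b)) - (2 / qtwo) *\<^sub>c mf1 (mf2 (mf2 b)) = 0"
    "(2 / qtwo) *\<^sub>c me1 (me2 (me2 a)) - 2 *\<^sub>c me2 (me1 (me2 a)) = 0"
    by (simp_all add: qtwo_nz)
qed

lemma laplace0:
  assumes a: "form0 a"
  shows "2 *\<^sub>c mf2 (me2 a) - (2 / qtwo) *\<^sub>c mf1 (mf2 (me1 (me2 a))) = (1 / qtwo) *\<^sub>c (nact casimir_free a - 2 *\<^sub>c a)"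
proof -
  have w: "wt 1 1 1 a" and z: "nf a = a" "me1 a = 0" "mf1 a = 0" using a by (simp_all add: form0_def)
  \<comment> \<open>At trivial weight the bracket is 2(q^2 + q^(-2)) - 4; the resulting scalar 2 is
    the constant subtracted from the Casimir element.\<close>
  have "(1 + 1 / 1) * (\<rho>^12 * 1^2 * 1 + 1 / (\<rho>^12 * 1^2 * 1)) + 1^2 + 1 / 1^2 - 6 = (\<rho>^6 - 1 / \<rho>^6)^2 * 2"
    by (simp add: field_simps power2_eq_square)
  then have c: "\<delta>^2 * ((1 + 1 / 1) * (\<rho>^12 * 1^2 * 1 + 1 / (\<rho>^12 * 1^2 * 1)) + 1^2 + 1 / 1^2 - 6) = 2"
    by (simp only: delta_square)
  have "nact casimir_free a = 2 *\<^sub>c a + (2 * qtwo) *\<^sub>c mf2 (me2 a) - 2 *\<^sub>c mf1 (mf2 (me1 (me2 a)))"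
    unfolding nact_casimir[OF w one_neq_zero one_neq_zero one_neq_zero z(1)] c
    by (simp add: z nact_linear invariant_e2[OF w z(2,3)])
      (rule poly_mapping_eqI, simp add: lookup_simps qtwo_def field_simps)
  then show ?thesis by (simp add: smul_diff smul_add qtwo_nz)
qed

lemma laplace2:
  assumes b: "form2 b"
  shows "qtwo *\<^sub>c me2 (mf2 b) - me1 (me2 (mf1 (mf2 b))) = (1 / qtwo) *\<^sub>c (nact casimir_free b - 2 *\<^sub>c b)"
proof -
  have w: "wt 1 (\<rho>^18) (1 / \<rho>^6) b" and z: "nf b = b" "me1 b = 0" "mf1 b = 0"
    using b by (simp_all add: form2_def)
  have nz: "\<rho>^18 \<noteq> 0" "1 / \<rho>^6 \<noteq> 0" by simp_all
  \<comment> \<open>The scalar is 2 + [2]^2 [3]. After subtracting 2 and dividing by [2], the term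
    [2][3] left over is the one that the commutator of \<open>E N2\<close> and \<open>F N2\<close>
    on \<open>b\<close> produces.\<close>
  have "(1 / \<rho>^6 + 1 / (1 / \<rho>^6)) * (\<rho>^12 * 1^2 * \<rho>^18 + 1 / (\<rho>^12 * 1^2 * \<rho>^18)) + (1 / \<rho>^6)^2 + 1 / (1 / \<rho>^6)^2 - 6
      = (\<rho>^6 - 1 / \<rho>^6)^2 * (2 + qtwo^2 * (qtwo^2 - 1))"
    by (simp add: qtwo_def field_simps power2_eq_square)
  then have c: "\<delta>^2 * ((1 / \<rho>^6 + 1 / (1 / \<rho>^6)) * (\<rho>^12 * 1^2 * \<rho>^18 + 1 / (\<rho>^12 * 1^2 * \<rho>^18)) + (1 / \<rho>^6)^2 + 1 / (1 / \<rho>^6)^2 - 6)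
      = 2 + qtwo^2 * (qtwo^2 - 1)"
    by (simp only: delta_square)
  have e2: "me2 (mf2 b) = mf2 (me2 b) + (qtwo^2 - 1) *\<^sub>c b"
    using nact_ef_2[OF w] by (simp only: delta_3)
  \<comment> \<open>\<open>mf2 (me2 b)\<close> has \<open>K N1\<close>-eigenvalue 1, so
    \<open>E N1\<close> and \<open>F N1\<close> commute on it.\<close>
  have e1: "me1 (mf1 (mf2 (me2 b))) = mf1 (mf2 (me1 (me2 b)))"
    using nact_ef_1[OF wt_loops(2)[OF w]] by (simp add: nact_ef_comm)
  have e12: "me1 (me2 (mf1 (mf2 b))) = mf1 (mf2 (me1 (me2 b)))"
    by (simp add: nact_ef_comm(2) e2 nact_linear z e1)
  have "nact casimir_free b = (2 + qtwo^2 * (qtwo^2 - 1)) *\<^sub>c b + qtwo^2 *\<^sub>c mf2 (me2 b) - qtwo *\<^sub>c mf1 (mf2 (me1 (me2 b)))"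
    unfolding nact_casimir[OF w one_neq_zero nz z(1)] c
    by (simp add: z nact_linear invariant_e2[OF w z(2,3)])
      (rule poly_mapping_eqI, simp add: lookup_simps qtwo_def field_simps power2_eq_square)
  then show ?thesis unfolding e12 unfolding e2
    by (simp add: qtwo_nz) (rule poly_mapping_eqI, simp add: lookup_simps field_simps qtwo_nz power2_eq_square)
qed

text \<open>\<open>t\<close> is the degree 0 component of D on \<open>x\<close>, \<open>y\<close>.
  The term with \<open>t\<close> is the differential of the adjoint; the other two are s^2 times the
  adjoint of the differential, with 2 s^2 = [2] inserted.\<close>

lemma laplace1:
  assumes xy: "form1 x y" and t: "t = 2 *\<^sub>c mf2 y - (2 / qtwo) *\<^sub>c mf1 (mf2 x)"
  shows "me1 (me2 t) + qtwo *\<^sub>c mf2 (me2 x) - mf2 (me1 (me2 y)) = (1 / qtwo) *\<^sub>c (nact casimir_free x - 2 *\<^sub>c x)"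
    and "me2 t + qtwo *\<^sub>c mf1 (mf2 (me2 x)) - mf1 (mf2 (me1 (me2 y))) = (1 / qtwo) *\<^sub>c (nact casimir_free y - 2 *\<^sub>c y)"
proof -
  have wx: "wt (\<rho>^3) (\<rho>^6) 1 x" and wy: "wt (1 / \<rho>^3) (\<rho>^12) (1 / \<rho>^6) y"
    and z: "nf x = x" "nf y = y" "me1 x = 0" "me1 y = x" "mf1 x = y" "mf1 y = 0" using xy by (simp_all add: form1_def)
  have nz: "\<rho>^3 \<noteq> 0" "\<rho>^6 \<noteq> 0" "\<rho>^12 \<noteq> 0" "1 / \<rho>^3 \<noteq> 0" "1 / \<rho>^6 \<noteq> 0" by simp_all
  have e2f2: "me2 (mf2 y) = mf2 (me2 y) + qtwo *\<^sub>c y" "me2 (mf2 x) = mf2 (me2 x) + x"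
    using nact_ef_2[OF wx] nact_ef_2[OF wy] by (simp_all only: delta_1 delta_2 smul_one)
  have e2t: "me2 t = 2 *\<^sub>c mf2 (me2 y) + (2 * qtwo - 2 / qtwo) *\<^sub>c y - (2 / qtwo) *\<^sub>c mf1 (mf2 (me2 x))"
    unfolding t by (simp add: nact_linear nact_ef_comm e2f2 z smul_add smul_diff_left algebra_simps)
  \<comment> \<open>\<open>mf2 (me2 x)\<close> has the \<open>K N1\<close>-eigenvalue q^(1/2), so
    the commutator scalar is [1] = 1.\<close>
  have "\<delta> * ((\<rho>^3)^2 - 1 / (\<rho>^3)^2) = 1" using delta_1 by simp
  then have e1f1: "me1 (mf1 (mf2 (me2 x))) = mf1 (mf2 (me1 (me2 x))) + mf2 (me2 x)"
    using nact_ef_1[OF wt_loops(2)[OF wx]] by (simp only: nact_ef_comm smul_one)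
  have e12t: "me1 (me2 t) = 2 *\<^sub>c mf2 (me1 (me2 y)) + (2 * qtwo - 2 / qtwo) *\<^sub>c x
      - (2 / qtwo) *\<^sub>c mf1 (mf2 (me1 (me2 x))) - (2 / qtwo) *\<^sub>c mf2 (me2 x)"
    unfolding e2t by (simp add: nact_linear e1f1 z nact_ef_comm smul_add algebra_simps)

  have "(1 + 1 / 1) * (\<rho>^12 * (\<rho>^3)^2 * \<rho>^6 + 1 / (\<rho>^12 * (\<rho>^3)^2 * \<rho>^6)) + 1^2 + 1 / 1^2 - 6
      = (\<rho>^6 - 1 / \<rho>^6)^2 * (2 * qtwo^2)"
    by (simp add: qtwo_def field_simps power2_eq_square)
  then have cx: "\<delta>^2 * ((1 + 1 / 1) * (\<rho>^12 * (\<rho>^3)^2 * \<rho>^6 + 1 / (\<rho>^12 * (\<rho>^3)^2 * \<rho>^6)) + 1^2 + 1 / 1^2 - 6) = 2 * qtwo^2"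
    by (simp only: delta_square)
  have "nact casimir_free x = (2 * qtwo^2) *\<^sub>c x + (qtwo^2 - 2) *\<^sub>c mf2 (me2 x) + qtwo *\<^sub>c mf2 (me1 (me2 y))
      - 2 *\<^sub>c mf1 (mf2 (me1 (me2 x)))"
    unfolding nact_casimir[OF wx nz(1,2) one_neq_zero z(1)] cx
    by (simp add: z nact_linear form1_facts[OF xy])
      (rule poly_mapping_eqI, simp add: lookup_simps qtwo_def field_simps power2_eq_square)
  then show "me1 (me2 t) + qtwo *\<^sub>c mf2 (me2 x) - mf2 (me1 (me2 y)) = (1 / qtwo) *\<^sub>c (nact casimir_free x - 2 *\<^sub>c x)"
    unfolding e12t by simp (rule poly_mapping_eqI, simp add: lookup_simps field_simps qtwo_nz power2_eq_square)

  \<comment> \<open>The Cartan scalar is [2]^2 + 2 here but 2[2]^2 for \<open>x\<close>. The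
    difference [2]^2 - 2 = q^2 + q^(-2) is the coefficient of \<open>mf1 (me1 y)\<close>, which
    equals \<open>y\<close>.\<close>
  have "(1 / \<rho>^6 + 1 / (1 / \<rho>^6)) * (\<rho>^12 * (1 / \<rho>^3)^2 * \<rho>^12 + 1 / (\<rho>^12 * (1 / \<rho>^3)^2 * \<rho>^12)) + (1 / \<rho>^6)^2 + 1 / (1 / \<rho>^6)^2 - 6
      = (\<rho>^6 - 1 / \<rho>^6)^2 * (qtwo^2 + 2)"
    by (simp add: qtwo_def field_simps power2_eq_square)
  then have cy: "\<delta>^2 * ((1 / \<rho>^6 + 1 / (1 / \<rho>^6)) * (\<rho>^12 * (1 / \<rho>^3)^2 * \<rho>^12 + 1 / (\<rho>^12 * (1 / \<rho>^3)^2 * \<rho>^12)) + (1 / \<rho>^6)^2 + 1 / (1 / \<rho>^6)^2 - 6)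
      = qtwo^2 + 2"
    by (simp only: delta_square)
  have "nact casimir_free y = (2 * qtwo^2) *\<^sub>c y + (2 * qtwo) *\<^sub>c mf2 (me2 y) - qtwo *\<^sub>c mf1 (mf2 (me1 (me2 y)))
      + (qtwo^2 - 2) *\<^sub>c mf1 (mf2 (me2 x))"
    unfolding nact_casimir[OF wy nz(4,3,5) z(2)] cy
    by (simp add: z nact_linear form1_facts[OF xy])
      (rule poly_mapping_eqI, simp add: lookup_simps qtwo_def field_simps power2_eq_square)
  then show "me2 t + qtwo *\<^sub>c mf1 (mf2 (me2 x)) - mf1 (mf2 (me1 (me2 y))) = (1 / qtwo) *\<^sub>c (nact casimir_free y - 2 *\<^sub>c y)"
    unfolding e2t by simp (rule poly_mapping_eqI, simp add: lookup_simps field_simps qtwo_nz power2_eq_square)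
qed

section \<open>Forms and the Dolbeault Laplacian\<close>

text \<open>The action on constants is given by the counit, so the counit vanishes on an ideal that
  acts as zero.\<close>

lemma U_eps_residue: "U_eps (ucl q h) = eps_free h"
proof -
  have "eps_free i = 0" if "i \<in> U_ideal q" for i
  proof -
    have "scalar (eps_free i) = (0 :: afree)"
      using act_free_U_ideal[OF that, of "scalar 1"] by (simp add: act_free_scalar eps_free_theta)
    then have "Poly_Mapping.lookup (scalar (eps_free i) :: afree) 0 = 0" by simp
    then show ?thesis by (simp add: scalar_def)
  qed
  then have "eps_free ` ucl q h = {eps_free h}"
    using residue_self[of h "U_rels q"] by (auto simp: residue_alt eps_free_simps)
  then show ?thesis by (simp add: U_eps_def)
qed

lemma acl_nf: "acl q (nf x) = acl q x"
  by (simp add: acl_eq_iff)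

lemma act_residue_nact: "act q (ucl q h) (acl q x) = acl q (nact h x)"
  by (simp add: act_residue acl_eq_iff nact_def)

lemma ASU3_simps:
  "acl q x \<oplus>\<^bsub>ASU3 q\<^esub> acl q y = acl q (x + y)"
  "\<ominus>\<^bsub>ASU3 q\<^esub> acl q x = acl q (- x)"
  "acl q x \<ominus>\<^bsub>ASU3 q\<^esub> acl q y = acl q (x - y)"
  "\<zero>\<^bsub>ASU3 q\<^esub> = acl q 0"
  "A_scale q c (acl q x) = acl q (c *\<^sub>c x)"
  "acl q x \<in> carrier (ASU3 q)"
  by (simp_all add: ASU3_def A_scale_def presented_simps smul_def)

lemma carrier_ASU3: "carrier (ASU3 q) = {acl q x | x. nf x = x}"
proof -
  have "\<exists>y. acl q x = acl q y \<and> nf y = y" for x by (intro exI[of _ "nf x"]) (simp add: acl_nf)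
  then show ?thesis by (auto simp: ASU3_def presented_simps)
qed

lemma nact_Usu2:
  assumes z: "Poly_Mapping.keys z \<subseteq> lists {gK N1, gKi N1, gE N1, gF N1}"
    and x: "nf x = x" "me1 x = 0" "mf1 x = 0" "mk1 x = x"
  shows "nact z x = eps_free z *\<^sub>c x"
proof -
  have k: "mk1i x = x" using nact_comm(5)[of x] x by simp
  have word: "nact (Poly_Mapping.single w c) x = eps_free (Poly_Mapping.single w c) *\<^sub>c x"
    if "w \<in> lists {gK N1, gKi N1, gE N1, gF N1}" for w c
    using that
  proof induction
    case Nil
    show ?case by (simp add: single_Nil eps_free_simps) (simp add: scalar_alt nact_alg x)
  next
    case (Cons g w)
    have "nact (gen g) x = eps_gen g *\<^sub>c x" using Cons.hyps by (auto simp: x k)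
    then show ?case using Cons.IH
      by (simp add: single_Cons nact_alg nact_linear eps_free_simps mult.commute)
  qed
  have "nact (\<Sum>w\<in>S. Poly_Mapping.single w (Poly_Mapping.lookup z w)) x
    = eps_free (\<Sum>w\<in>S. Poly_Mapping.single w (Poly_Mapping.lookup z w)) *\<^sub>c x" if "finite S" "S \<subseteq> Poly_Mapping.keys z" for S
    using that
  proof (induction S rule: finite_induct)
    case empty
    have "eps_free 0 = 0" by (simp add: eps_free_def alg_ext_def)
    then show ?case by (simp add: nact_def act_free_zero_left nf_zero)
  next
    case (insert w S)
    then show ?case using z by (simp add: nact_alg word eps_free_simps smul_add_left subset_iff)
  qed
  from this[of "Poly_Mapping.keys z"] show ?thesis by (simp add: poly_mapping_sum_singles)
qed

lemma acl_mem_AS5_iff: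
  assumes x: "nf x = x"
  shows "acl q x \<in> AS5 q \<longleftrightarrow> me1 x = 0 \<and> mf1 x = 0 \<and> mk1 x = x"
proof
  assume A: "acl q x \<in> AS5 q"
  have "nact (gen g) x = eps_gen g *\<^sub>c x" if "g \<in> {gK N1, gKi N1, gE N1, gF N1}" for g
  proof -
    have "ucl q (gen g) \<in> Usu2 q"
      using that unfolding Usu2_def by (intro imageI) (auto simp: gen_def)
    then have "act q (ucl q (gen g)) (acl q x) = A_scale q (U_eps (ucl q (gen g))) (acl q x)"
      using A by (simp add: AS5_def)
    then show ?thesis
      by (simp add: act_residue_nact ASU3_simps U_eps_residue eps_free_simps acl_eq_iff nf_linear x)
  qed
  from this[of "gE N1"] this[of "gF N1"] this[of "gK N1"] show "me1 x = 0 \<and> mf1 x = 0 \<and> mk1 x = x" by simp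
next
  assume A: "me1 x = 0 \<and> mf1 x = 0 \<and> mk1 x = x"
  then show "acl q x \<in> AS5 q"
    by (auto simp: AS5_def ASU3_simps Usu2_def act_residue_nact U_eps_residue nact_Usu2[OF _ x])
qed

text \<open>The definition of forms supplies the eigenvalues \<open>a\<close> and
  \<open>a * b\<close>; their quotient belongs to \<open>(K N2)^2\<close>, and the positive cube
  root \<open>t\<close> of \<open>a^2 / b\<close> belongs to \<open>H\<close>.\<close>

lemma wtI:
  assumes x: "nf x = x" and k1: "mk1 x = a *\<^sub>c x" and k2: "mk1 (mk2 (mk2 x)) = (a * b) *\<^sub>c x"
    and nz: "a \<noteq> 0" "b \<noteq> 0" and t: "t > 0" "of_real (t^3) = a^2 / b" and c: "c = of_real t"
  shows "wt a b c x"
proof -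
  have k1i: "mk1i x = (1 / a) *\<^sub>c x"
  proof -
    have "x = a *\<^sub>c mk1i x" using nact_comm(5)[of x] by (simp add: k1 x nact_linear)
    then show ?thesis using nz by (metis smul_eq_imp)
  qed
  have k2': "mk2 (mk2 x) = b *\<^sub>c x"
  proof -
    have "mk2 (mk2 x) = mk1i (mk1 (mk2 (mk2 x)))" by (simp add: nact_comm)
    also have "\<dots> = b *\<^sub>c x" unfolding k2 using nz by (simp add: nact_linear k1i)
    finally show ?thesis .
  qed
  have k2i: "mk2i (mk2i x) = (1 / b) *\<^sub>c x"
  proof -
    have "x = mk2i (mk2i (mk2 (mk2 x)))" by (simp add: nact_comm x)
    then have "x = b *\<^sub>c mk2i (mk2i x)" by (simp add: k2' nact_linear)
    then show ?thesis using nz by (metis smul_eq_imp)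
  qed
  have "mh (mh (mh x)) = mk1 (mk1 (mk2i (mk2i x)))"
    by (simp add: nact_nact h_cube nf_act_free_nf nact_def)
  also have "\<dots> = of_real (t^3) *\<^sub>c x"
    unfolding t by (simp add: k2i k1 nact_linear power2_eq_square)
  finally have h: "mh x = c *\<^sub>c x"
    unfolding c using H_cube_root[OF x _ t(1)] by simp
  have "mhi x = (1 / c) *\<^sub>c x"
  proof -
    have "x = c *\<^sub>c mhi x" using nact_comm(8)[of x] by (simp add: h x nact_linear)
    then show ?thesis using t(1) c by (intro smul_eq_imp) simp_all
  qed
  with k1 k1i k2' k2i h show ?thesis by (simp add: wt_def)
qed

lemma wt_K1_K2: "wt a b c x \<Longrightarrow> mk1 (mk2 (mk2 x)) = (a * b) *\<^sub>c x"
  by (simp add: wt_def nact_linear mult.commute)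

lemma nact_K1_K2: "nact (K N1 * (K N2)^2) x = mk1 (mk2 (mk2 x))"
  by (simp add: nact_alg power2_eq_square)

lemma acl_mem_LN_iff:
  assumes x: "nf x = x"
  shows "acl q x \<in> LN q N \<longleftrightarrow> me1 x = 0 \<and> mf1 x = 0 \<and> mk1 x = x \<and> mk1 (mk2 (mk2 x)) = of_real (q powi N) *\<^sub>c x"
  by (simp add: LN_def acl_mem_AS5_iff[OF x] act_residue_nact nact_K1_K2 ASU3_simps acl_eq_iff nf_linear x)

lemma acl_mem_Omega00_iff:
  assumes x: "nf x = x"
  shows "acl q x \<in> Omega00 q \<longleftrightarrow> form0 x"
proof
  assume "acl q x \<in> Omega00 q"
  then have "me1 x = 0" "mf1 x = 0" "mk1 x = x" "mk1 (mk2 (mk2 x)) = x"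
    by (simp_all add: Omega00_def acl_mem_LN_iff[OF x])
  moreover from this have "wt 1 1 1 x" by (intro wtI[OF x, of _ _ 1]) simp_all
  ultimately show "form0 x" by (simp add: form0_def x)
next
  assume f: "form0 x"
  then have "wt 1 1 1 x" by (simp add: form0_def)
  with f wt_K1_K2[OF this] show "acl q x \<in> Omega00 q"
    by (simp add: Omega00_def acl_mem_LN_iff[OF x] form0_def wt_def)
qed

lemma acl_mem_Omega02_iff:
  assumes x: "nf x = x"
  shows "acl q x \<in> Omega02 q \<longleftrightarrow> form2 x"
proof -
  have q3: "complex_of_real q ^ 3 = \<rho>^18"
    by (simp add: powr_rho flip: power_mult)
  show ?thesis
  proof
    assume "acl q x \<in> Omega02 q"
    then have "me1 x = 0" "mf1 x = 0" "mk1 x = x" "mk1 (mk2 (mk2 x)) = \<rho>^18 *\<^sub>c x"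
      by (simp_all add: Omega02_def acl_mem_LN_iff[OF x] q3)
    moreover from this have "wt 1 (\<rho>^18) (1 / \<rho>^6) x"
      using q_pos by (intro wtI[OF x, of _ _ "1 / q"]) (simp_all add: powr_rho power_divide flip: power_mult)
    ultimately show "form2 x" by (simp add: form2_def x)
  next
    assume f: "form2 x"
    then have "wt 1 (\<rho>^18) (1 / \<rho>^6) x" by (simp add: form2_def)
    with f wt_K1_K2[OF this] show "acl q x \<in> Omega02 q"
      by (simp add: Omega02_def acl_mem_LN_iff[OF x] q3 form2_def wt_def)
  qed
qed

lemma acl_mem_Omega01_iff:
  assumes x: "nf x = x" and y: "nf y = y"
  shows "(acl q x, acl q y) \<in> Omega01 q \<longleftrightarrow> form1 x y"
proof -
  have p: "complex_of_real (q powr (3 / 2)) = \<rho>^9"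
    by (simp add: rho_power)
  have eq: "(acl q x, acl q y) \<in> Omega01 q \<longleftrightarrow> mk1 (mk2 (mk2 x)) = \<rho>^9 *\<^sub>c x \<and> mk1 (mk2 (mk2 y)) = \<rho>^9 *\<^sub>c y \<and>
      mk1 x = \<rho>^3 *\<^sub>c x \<and> mk1 y = (1 / \<rho>^3) *\<^sub>c y \<and> me1 x = 0 \<and> me1 y = x \<and> mf1 x = y \<and> mf1 y = 0"
    by (simp add: Omega01_def act_residue_nact nact_K1_K2 ASU3_simps acl_eq_iff nf_linear x y p powr_rho)
  show ?thesis
  proof
    assume "(acl q x, acl q y) \<in> Omega01 q"
    then have A: "mk1 (mk2 (mk2 x)) = \<rho>^9 *\<^sub>c x" "mk1 (mk2 (mk2 y)) = \<rho>^9 *\<^sub>c y"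
      "mk1 x = \<rho>^3 *\<^sub>c x" "mk1 y = (1 / \<rho>^3) *\<^sub>c y" and B: "me1 x = 0" "me1 y = x" "mf1 x = y" "mf1 y = 0"
      unfolding eq by blast+
    have "wt (\<rho>^3) (\<rho>^6) 1 x"
      by (rule wtI[OF x A(3), of _ 1]) (simp_all add: A(1) flip: power_add power_mult)
    moreover have "wt (1 / \<rho>^3) (\<rho>^12) (1 / \<rho>^6) y"
    \<comment> \<open>Here \<open>b\<close> is q^(3/2) / q^(-1/2) = q^2 and \<open>a^2 / b\<close>
      is q^(-3), whence the cube root \<open>1 / q\<close>.\<close>
    proof (rule wtI[OF y A(4), of _ "1 / q"])
      show "mk1 (mk2 (mk2 y)) = (1 / \<rho>^3 * \<rho>^12) *\<^sub>c y" unfolding A(2) by (simp add: field_simps)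
      show "complex_of_real ((1 / q) ^ 3) = (1 / \<rho> ^ 3)\<^sup>2 / \<rho> ^ 12"
        by (simp add: powr_rho power_divide flip: power_mult)
    qed (use q_pos in \<open>simp_all add: powr_rho\<close>)
    ultimately show "form1 x y" using B x y by (simp add: form1_def)
  next
    assume f: "form1 x y"
    then have w: "wt (\<rho>^3) (\<rho>^6) 1 x" "wt (1 / \<rho>^3) (\<rho>^12) (1 / \<rho>^6) y" by (simp_all add: form1_def)
    have "\<rho>^3 * \<rho>^6 = \<rho>^9" "1 / \<rho>^3 * \<rho>^12 = \<rho>^9" by (simp_all add: field_simps)
    then have "mk1 (mk2 (mk2 x)) = \<rho>^9 *\<^sub>c x" "mk1 (mk2 (mk2 y)) = \<rho>^9 *\<^sub>c y"
      using wt_K1_K2[OF w(1)] wt_K1_K2[OF w(2)] by simp_all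
    with f w show "(acl q x, acl q y) \<in> Omega01 q"
      unfolding eq by (simp add: form1_def wt_def)
  qed
qed

lemma Omega_cases:
  assumes "\<omega> \<in> Omega q"
  obtains a x y b where "\<omega> = (acl q a, (acl q x, acl q y), acl q b)" "form0 a" "form1 x y" "form2 b"
proof -
  obtain A X Y B where \<omega>: "\<omega> = (A, (X, Y), B)" by (metis prod_cases3 surj_pair)
  then have mem: "A \<in> Omega00 q" "(X, Y) \<in> Omega01 q" "B \<in> Omega02 q" using assms by (auto simp: Omega_def)
  then have "A \<in> carrier (ASU3 q)" "X \<in> carrier (ASU3 q)" "Y \<in> carrier (ASU3 q)" "B \<in> carrier (ASU3 q)"
    by (auto simp: Omega00_def Omega01_def Omega02_def LN_def AS5_def)
  then obtain a x y b where "A = acl q a" "nf a = a" "X = acl q x" "nf x = x" "Y = acl q y" "nf y = y" "B = acl q b" "nf b = b"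
    unfolding carrier_ASU3 by blast
  with mem \<omega> that show thesis
    by (simp add: acl_mem_Omega00_iff acl_mem_Omega01_iff acl_mem_Omega02_iff)
qed

lemma Omega_memI:
  "form0 a \<Longrightarrow> form1 x y \<Longrightarrow> form2 b \<Longrightarrow> (acl q a, (acl q x, acl q y), acl q b) \<in> Omega q"
  unfolding Omega_def
  by (simp add: acl_mem_Omega00_iff acl_mem_Omega01_iff acl_mem_Omega02_iff form0_def form1_def form2_def)

section \<open>The operator D on representatives and its square\<close>

lemma qnum_2: "qnum q 2 = q + 1 / q"
proof -
  have "1 < 1 / q" using q_pos q_less_1 by simp
  then have "q - 1 / q \<noteq> 0" using q_less_1 by linarith
  moreover have "q powr 2 - q powr (- 2) = (q + 1 / q) * (q - 1 / q)"
    using q_pos by (simp add: powr_minus field_simps power2_eq_square)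
  ultimately show ?thesis by (simp add: qnum_def)
qed

lemma qnum_qtwo: "complex_of_real (qnum q 2) = qtwo"
  by (simp only: qnum_2 qtwo_real)

lemma nact_X: "nact (F N2 * F N1 - scalar (2 / qnum q 2) * F N1 * F N2) x = mf2 (mf1 x) - (2 / qtwo) *\<^sub>c mf1 (mf2 x)"
  and nact_Y: "nact (E N2 * E N1 - scalar (2 / qnum q 2) * E N1 * E N2) x = me2 (me1 x) - (2 / qtwo) *\<^sub>c me1 (me2 x)"
  and nact_X_star: "nact (star_free (F N2 * F N1 - scalar (2 / qnum q 2) * F N1 * F N2)) x = me1 (me2 x) - (2 / qtwo) *\<^sub>c me2 (me1 x)"
  and nact_Y_star: "nact (star_free (E N2 * E N1 - scalar (2 / qnum q 2) * E N1 * E N2)) x = mf1 (mf2 x) - (2 / qtwo) *\<^sub>c mf2 (mf1 x)"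
proof -
  have "cnj qtwo = qtwo" by (simp add: qtwo_real)
  then show "nact (F N2 * F N1 - scalar (2 / qnum q 2) * F N1 * F N2) x = mf2 (mf1 x) - (2 / qtwo) *\<^sub>c mf1 (mf2 x)"
    "nact (E N2 * E N1 - scalar (2 / qnum q 2) * E N1 * E N2) x = me2 (me1 x) - (2 / qtwo) *\<^sub>c me1 (me2 x)"
    "nact (star_free (F N2 * F N1 - scalar (2 / qnum q 2) * F N1 * F N2)) x = me1 (me2 x) - (2 / qtwo) *\<^sub>c me2 (me1 x)"
    "nact (star_free (E N2 * E N1 - scalar (2 / qnum q 2) * E N1 * E N2)) x = mf1 (mf2 x) - (2 / qtwo) *\<^sub>c mf2 (mf1 x)"
    by (simp_all add: scalar_mult smul_mult_left star_free_diff star_free_smul star_free_mult star_free_gen nact_alg qnum_qtwo)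
qed

text \<open>\<open>me1 a = 0\<close> and \<open>mf1 b = 0\<close> remove the second terms of the
  adjoints of X and Y, while \<open>mf1 x = y\<close> and \<open>me1 y = x\<close> double the terms
  \<open>mf2 y\<close> and \<open>me2 x\<close>.\<close>

lemma Dirac_acl:
  assumes a: "form0 a" and xy: "form1 x y" and b: "form2 b"
  shows "Dirac q s (acl q a, (acl q x, acl q y), acl q b) =
    (acl q (2 *\<^sub>c mf2 y - (2 / qtwo) *\<^sub>c mf1 (mf2 x)),
     (acl q (me1 (me2 a) - s *\<^sub>c mf2 b), acl q (me2 a - s *\<^sub>c mf1 (mf2 b))),
     acl q (s *\<^sub>c ((2 / qtwo) *\<^sub>c me1 (me2 y) - 2 *\<^sub>c me2 x)))"
proof -
  have z: "me1 a = 0" "mf1 b = 0" "mf1 x = y" "me1 y = x"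
    using a xy b by (simp_all add: form0_def form1_def form2_def)
  have two_smul: "2 *\<^sub>c z = z + z" for z :: afree
    using smul_add_left[of 1 1 z] by simp
  have eqs:
    "mf2 (mf1 x) - (2 / qtwo) *\<^sub>c mf1 (mf2 x) + mf2 y = 2 *\<^sub>c mf2 y - (2 / qtwo) *\<^sub>c mf1 (mf2 x)"
    "me1 (me2 a) - (2 / qtwo) *\<^sub>c me2 (me1 a) + s *\<^sub>c - mf2 b = me1 (me2 a) - s *\<^sub>c mf2 b"
    "me2 a + s *\<^sub>c - (mf1 (mf2 b) - (2 / qtwo) *\<^sub>c mf2 (mf1 b)) = me2 a - s *\<^sub>c mf1 (mf2 b)"
    "- me2 x - (me2 (me1 y) - (2 / qtwo) *\<^sub>c me1 (me2 y)) = (2 / qtwo) *\<^sub>c me1 (me2 y) - 2 *\<^sub>c me2 x"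
    by (simp_all add: z nact_linear smul_minus two_smul)
  show ?thesis
    by (simp only: Dirac_def dbar0_def dbar1_def dbar_dag1_def dbar_dag2_def Xel_def Yel_def prod.case fst_conv snd_conv
        U_star_residue act_residue_nact ASU3_simps nact_X nact_Y nact_X_star nact_Y_star eqs)
qed

lemma Dirac_mem_Omega:
  assumes "\<omega> \<in> Omega q"
  shows "Dirac q s \<omega> \<in> Omega q"
  using assms
proof (rule Omega_cases)
  fix a x y b assume "\<omega> = (acl q a, (acl q x, acl q y), acl q b)" "form0 a" "form1 x y" "form2 b"
  then show ?thesis
    by (simp add: Dirac_acl Omega_memI form0_image form1_image form2_image)
qed

lemma nact_scaled_casimir:
  "A_scale q (1 / qnum q 2) (act q (casimir q \<ominus>\<^bsub>Uq q\<^esub> ucl q (scalar 2)) (acl q x)) =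
    acl q ((1 / qtwo) *\<^sub>c (nact casimir_free x - 2 *\<^sub>c x))"
proof -
  have c: "casimir q \<ominus>\<^bsub>Uq q\<^esub> ucl q (scalar 2) = ucl q (casimir_free - scalar 2)"
    by (simp only: casimir_def casimir_free_def Uq_def presented_simps)
  show ?thesis
    unfolding c act_residue_nact
    by (simp add: ASU3_simps qnum_qtwo scalar_alt nact_alg acl_eq_iff nf_linear)
qed

lemma Dirac_square:
  assumes "\<omega> \<in> Omega q" and s: "s * s = qnum q 2 / 2"
  shows "Dirac q s (Dirac q s \<omega>) =
    comp_scale q (1 / qnum q 2) (comp_act q (casimir q \<ominus>\<^bsub>Uq q\<^esub> ucl q (scalar 2)) \<omega>)"
  using assms(1)
proof (rule Omega_cases)
  fix a x y b
  assume \<omega>: "\<omega> = (acl q a, (acl q x, acl q y), acl q b)" and forms: "form0 a" "form1 x y" "form2 b"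
  have ss: "complex_of_real s * complex_of_real s = qtwo / 2"
    using s qnum_qtwo by (metis of_real_divide of_real_mult of_real_numeral)
  define a' x' y' b' where
    a': "a' = 2 *\<^sub>c mf2 y - (2 / qtwo) *\<^sub>c mf1 (mf2 x)" and
    x': "x' = me1 (me2 a) - s *\<^sub>c mf2 b" and y': "y' = me2 a - s *\<^sub>c mf1 (mf2 b)" and
    b': "b' = s *\<^sub>c ((2 / qtwo) *\<^sub>c me1 (me2 y) - 2 *\<^sub>c me2 x)"
  have forms': "form0 a'" "form1 x' y'" "form2 b'"
    unfolding a' x' y' b' using forms by (simp_all only: form0_image form1_image form2_image)
  have z: "me1 a = 0" "mf1 b = 0" using forms by (simp_all add: form0_def form2_def)
  \<comment> \<open>The part linear in \<open>s\<close> is the square of the adjoint differential on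
    \<open>b\<close> and drops out.\<close>
  have "2 *\<^sub>c mf2 y' - (2 / qtwo) *\<^sub>c mf1 (mf2 x') =
      (2 *\<^sub>c mf2 (me2 a) - (2 / qtwo) *\<^sub>c mf1 (mf2 (me1 (me2 a))))
      - s *\<^sub>c (2 *\<^sub>c mf2 (mf1 (mf2 b)) - (2 / qtwo) *\<^sub>c mf1 (mf2 (mf2 b)))"
    by (simp add: x' y' nact_linear smul_diff algebra_simps)
  then have A: "2 *\<^sub>c mf2 y' - (2 / qtwo) *\<^sub>c mf1 (mf2 x') = (1 / qtwo) *\<^sub>c (nact casimir_free a - 2 *\<^sub>c a)"
    by (simp only: form0_square[OF forms(1,3)] laplace0[OF forms(1)] smul_zero diff_zero)
  \<comment> \<open>\<open>s * s\<close> = [2]/2 meets the factors 2 and 2/[2] of \<open>b'\<close>,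
    which leaves the coefficients [2] and 1.\<close>
  have "me1 (me2 a') - s *\<^sub>c mf2 b' = me1 (me2 a') + qtwo *\<^sub>c mf2 (me2 x) - mf2 (me1 (me2 y))"
    by (simp add: b' nact_linear ss smul_diff qtwo_nz mult.assoc[symmetric])
  then have X: "me1 (me2 a') - s *\<^sub>c mf2 b' = (1 / qtwo) *\<^sub>c (nact casimir_free x - 2 *\<^sub>c x)"
    by (simp only: laplace1(1)[OF forms(2) a'])
  have "me2 a' - s *\<^sub>c mf1 (mf2 b') = me2 a' + qtwo *\<^sub>c mf1 (mf2 (me2 x)) - mf1 (mf2 (me1 (me2 y)))"
    by (simp add: b' nact_linear ss smul_diff qtwo_nz mult.assoc[symmetric])
  then have Y: "me2 a' - s *\<^sub>c mf1 (mf2 b') = (1 / qtwo) *\<^sub>c (nact casimir_free y - 2 *\<^sub>c y)"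
    by (simp only: laplace1(2)[OF forms(2) a'])
  \<comment> \<open>The first summand is \<open>s\<close> times the square of the differential on
    \<open>a\<close>, up to sign, and vanishes; the second is s^2 times the Laplacian on
    \<open>b\<close>.\<close>
  have "s *\<^sub>c ((2 / qtwo) *\<^sub>c me1 (me2 y') - 2 *\<^sub>c me2 x') =
      s *\<^sub>c ((2 / qtwo) *\<^sub>c me1 (me2 (me2 a)) - 2 *\<^sub>c me2 (me1 (me2 a)))
      + (qtwo *\<^sub>c me2 (mf2 b) - me1 (me2 (mf1 (mf2 b))))"
  proof -
    have "s *\<^sub>c ((2 / qtwo) *\<^sub>c me1 (me2 y') - 2 *\<^sub>c me2 x') =
        s *\<^sub>c ((2 / qtwo) *\<^sub>c me1 (me2 (me2 a)) - 2 *\<^sub>c me2 (me1 (me2 a)))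
        + (complex_of_real s * complex_of_real s) *\<^sub>c (2 *\<^sub>c me2 (mf2 b) - (2 / qtwo) *\<^sub>c me1 (me2 (mf1 (mf2 b))))"
      unfolding x' y' nact_linear
      by (rule poly_mapping_eqI) (simp add: lookup_simps algebra_simps)
    then show ?thesis unfolding ss by (simp add: smul_diff qtwo_nz)
  qed
  then have B: "s *\<^sub>c ((2 / qtwo) *\<^sub>c me1 (me2 y') - 2 *\<^sub>c me2 x') = (1 / qtwo) *\<^sub>c (nact casimir_free b - 2 *\<^sub>c b)"
    by (simp only: form0_square[OF forms(1,3)] laplace2[OF forms(3)] smul_zero add_0_left)
  show ?thesis
    unfolding \<omega> Dirac_acl[OF forms] a'[symmetric] x'[symmetric] y'[symmetric] b'[symmetric] Dirac_acl[OF forms'] A X Y B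
    by (simp only: comp_scale_def comp_act_def prod.case nact_scaled_casimir)
qed

end

theorem proposition6p2:
  fixes q s :: real
  assumes "0 < q" and "q < 1" and "s = sqrt (qnum q 2 / 2)"
  shows "Dirac q s \<in> Omega q \<rightarrow> Omega q \<and>
    (\<forall>\<omega>\<in>Omega q. Dirac q s (Dirac q s \<omega>) =
       comp_scale q (1 / qnum q 2) (comp_act q (casimir q \<ominus>\<^bsub>Uq q\<^esub> ucl q (scalar 2)) \<omega>))"
proof -
  interpret quantum_su3 q by standard (use assms in simp_all)
  have "qnum q 2 \<ge> 0" unfolding qnum_2 using \<open>0 < q\<close> by simp
  then have "s * s = qnum q 2 / 2" by (simp add: assms(3))
  then show ?thesis by (intro conjI Pi_I ballI Dirac_mem_Omega Dirac_square)
qed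

end
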